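(* Let $(T^1,F_1)$ and $(T^2,F_2)$ be rooted trees with sources over $(Q,\rho)$, and let $M_j:=M(T^j,F_j)$ for $j=1,2$ be the corresponding rooted tree modules. Then the pair $(M_1,M_2)$ is ghost-free, and hence $\mathrm{Hom}_\Lambda(M_1,M_2)$ is the $\mathcal K$-span of the set $\{\mathcal H_{\mathcal G}\mid\mathcal G\text{ is a generalized graph map from }M_1\text{ to }M_2\}$.
   Context: Fix a field $\mathcal K$ with $\mathrm{char}(\mathcal K)\neq 2$. Let $Q=(Q_0,Q_1,\varsigma,\varepsilon)$ be a quiver and $\rho$ a set of paths in $Q$ of length at least $2$ that bounds the length of the paths, not lying in the ideal $\langle\rho\rangle$, passing through any vertex. Put $\Lambda:=\mathcal KQ/\langle\rho\rangle$. Finite-dimensional $\Lambda$-modules are identified with finite-dimensional $\mathcal K$-representations of $(Q,\rho)$. A tree is a finite quiver $T=(T_0,T_1,s,t)$ whose underlying undirected graph is connected without cycles. Here rooted trees have a unique source $\ast$ (the root). For a non-root vertex $n$ there is a unique arrow with target $n$, denoted $a_n$ in $T^1$ and $b_n$ in $T^2$; its source is the parent $\mathsf p(n)$. A quiver morphism is a pair of maps (on vertices and on arrows) commuting with sources and targets. A quiver morphism $F:T\to Q$ is bound, written $F:T\to(Q,\rho)$, if there is no path $p$ in $T$ with $F(p)\in\langle\rho\rangle$; then $(T,F)$ is a tree over $(Q,\rho)$. The rooted tree module $M(T,F)$ has a $\mathcal K$-basis indexed by $T_0$, the basis vector $v_n$ lying at the vertex $F(n)$, and $\gamma\in Q_1$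 acts by $\gamma\cdot v_n=\sum_{a\in T_1,\ s(a)=n,\ F(a)=\gamma}v_{t(a)}$. Write $\{v_n\}_{n\in T^1_0}$ and $\{w_m\}_{m\in T^2_0}$ for these bases of $M_1$ and $M_2$. Networks. A network consists of a quiver together with a set of undirected edges forming a simple graph on the same vertex set. The pullback network $\mathcal N[1]$ has vertices $\mathcal N[1]_0=\{(n,m)\in T^1_0\times T^2_0\mid F_1(n)=F_2(m)\}$; arrows $\mathcal N[1]_1$: $(a_n,b_m):(\mathsf p(n),\mathsf p(m))\to(n,m)$ whenever $F_1(a_n)=F_2(b_m)$; edges $\mathcal E^1=\{\{(n,m),(n',m)\}\mid n\ne n',\ \mathsf p(n)=\mathsf p(n'),\ F_1(a_n)=F_1(a_{n'})\}$. The 2-covering network $\mathcal N[2]$ has $\mathcal N[2]_l=\mathcal N[1]_l\times\{-1,1\}$ for $l=0,1$ (sources and targets keep the sign) and edges $\mathcal E^2=\{\{(n,m,i),(n',m,-i)\}\mid\{(n,m),(n',m)\}\in\mathcal E^1,\ i\in\{-1,1\}\}$; $\pi:\mathcal N[2]\to\mathcal N[1]$ forgets the sign. A link is an arrow, a formal inverse of an arrow, or an edge. A traversal is a walk along links containing no $\alpha\alpha^{-1}$ as a subwalk (with $(\alpha^{-1})^{-1}=\alpha$ for an arrow and $\alpha^{-1}=\alpha$ for an edge); vertices are traversals of length $0$. A triangle in $\mathcal N[1]$ is an induced subnetwork on three vertices whose total number of arrows and edges is $3$. $\mathcal R[1]$ is the set of length-two traversals in $\mathcal N[1]$ through three vertices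 inducing a triangle, and $\mathcal R[2]$ is the set of traversals $\mathfrak t$ in $\mathcal N[2]$ with $\pi(\mathfrak t)\in\mathcal R[1]$. A subnetwork $\mathcal M=(\mathcal M_0,\mathcal M_1,\mathcal E_{\mathcal M})$ of $\mathcal N[2]$ is: $\mathcal R[2]$-free if no traversal in $\mathcal M$ lies in $\mathcal R[2]$; involution-free if $(n,m,j)\in\mathcal M_0$ implies $(n,m,-j)\notin\mathcal M_0$; connected if there is a traversal in $\mathcal M$ between any two of its vertices; complete if for each $(n,m,j)\in\mathcal M_0$: (i) if there is an arrow $a_n:n'\to n$ in $T^1$, then at least one of the following holds: there is an arrow $b_m:m'\to m$ in $T^2$ such that $(a_n,b_m,j):(n',m',j)\to(n,m,j)$ is in $\mathcal M_1$; or there is an arrow $a_{n''}:n'\to n''$ in $T^1$ with $F_1(a_n)=F_1(a_{n''})$, $(n'',m,-j)\in\mathcal M_0$ and $\{(n,m,j),(n'',m,-j)\}\in\mathcal E_{\mathcal M}$; (ii) for every arrow $b_{m'}:m\to m'$ in $T^2$ there is an arrow $a_{n'}:n\to n'$ in $T^1$ such that $(a_{n'},b_{m'},j):(n,m,j)\to(n',m',j)$ is in $\mathcal M_1$. A generalized graph map (GGM) from $M_1$ to $M_2$ is a non-empty, complete, connected, $\mathcal R[2]$-free and involution-free subnetwork of $\mathcal N[2]$. The linear map associated with a subnetwork $\mathcal M$ is $\mathcal H_{\mathcal M}:M_1\to M_2$, $\mathcal H_{\mathcal M}(v_n)=\sum_{(n,m,j)\in\mathcal M_0}j\,w_m$.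 A ghost is a non-empty, connected, complete and $\mathcal R[2]$-free subnetwork $\mathcal M$ of $\mathcal N[2]$ with $\mathcal H_{\mathcal M}=0$. The pair $(M_1,M_2)$ is ghost-free if $\mathcal N[2]$ does not include a ghost. *)

theory Defs
  imports Graph_Theory.Digraph_Component "HOL-Library.Function_Algebras"
begin

section \<open>Bound quivers\<close>

text \<open>
  A path is a pair \<open>(x, l)\<close> of its starting vertex and its list of arrows in order of traversal;
  \<open>(x, [])\<close> is the trivial path at \<open>x\<close>.
\<close>

type_synonym ('q, 'a) path = "'q \<times> 'a list"

definition is_path :: "('q, 'a) pre_digraph \<Rightarrow> ('q, 'a) path \<Rightarrow> bool" where
  "is_path Q p \<longleftrightarrow> (\<exists>y. pre_digraph.awalk Q (fst p) (snd p) y)"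

definition basis_elem :: "'b \<Rightarrow> 'b \<Rightarrow> 'k::zero_neq_one" where
  "basis_elem b = (\<lambda>x. if x = b then 1 else 0)"

definition vscale :: "'k::times \<Rightarrow> ('b \<Rightarrow> 'k) \<Rightarrow> 'b \<Rightarrow> 'k" where
  "vscale c v = (\<lambda>x. c * v x)"

definition path_algebra :: "('q, 'a) pre_digraph \<Rightarrow> (('q, 'a) path \<Rightarrow> 'k::field) set" where
  "path_algebra Q = {a. finite {p. a p \<noteq> 0} \<and> (\<forall>p. a p \<noteq> 0 \<longrightarrow> is_path Q p)}"

text \<open>
  Convolution along all factorizations of a path. As for left modules, the right factor is
  traversed first.
\<close>

definition path_mult ::
  "('q, 'a) pre_digraph \<Rightarrow> (('q, 'a) path \<Rightarrow> 'k::field) \<Rightarrow> (('q, 'a) path \<Rightarrow> 'k) \<Rightarrow> ('q, 'a) path \<Rightarrow> 'k" where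
  "path_mult Q a b = (\<lambda>(x, l). \<Sum>i\<le>length l.
     a (last (pre_digraph.awalk_verts Q x (take i l)), drop i l) * b (x, take i l))"

inductive_set path_ideal ::
  "('q, 'a) pre_digraph \<Rightarrow> ('q, 'a) path set \<Rightarrow> (('q, 'a) path \<Rightarrow> 'k::field) set"
  for Q :: "('q, 'a) pre_digraph" and \<rho> :: "('q, 'a) path set" where
  gen: "p \<in> \<rho> \<Longrightarrow> basis_elem p \<in> path_ideal Q \<rho>"
| zero: "0 \<in> path_ideal Q \<rho>"
| add: "a \<in> path_ideal Q \<rho> \<Longrightarrow> b \<in> path_ideal Q \<rho> \<Longrightarrow> a + b \<in> path_ideal Q \<rho>"
| scale: "a \<in> path_ideal Q \<rho> \<Longrightarrow> vscale c a \<in> path_ideal Q \<rho>"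
| left: "a \<in> path_algebra Q \<Longrightarrow> b \<in> path_ideal Q \<rho> \<Longrightarrow> path_mult Q a b \<in> path_ideal Q \<rho>"
| right: "a \<in> path_ideal Q \<rho> \<Longrightarrow> b \<in> path_algebra Q \<Longrightarrow> path_mult Q a b \<in> path_ideal Q \<rho>"

definition in_ideal ::
  "'k::field itself \<Rightarrow> ('q, 'a) pre_digraph \<Rightarrow> ('q, 'a) path set \<Rightarrow> ('q, 'a) path \<Rightarrow> bool" where
  "in_ideal _ Q \<rho> p \<longleftrightarrow> (basis_elem p :: _ \<Rightarrow> 'k) \<in> path_ideal Q \<rho>"

text \<open>The bound on the lengths of the paths through a vertex may depend on the vertex.\<close>

definition bound_quiver ::
  "'k::field itself \<Rightarrow> ('q, 'a) pre_digraph \<Rightarrow> ('q, 'a) path set \<Rightarrow> bool" where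
  "bound_quiver K Q \<rho> \<longleftrightarrow>
     wf_digraph Q \<and>
     (\<forall>p\<in>\<rho>. is_path Q p \<and> 2 \<le> length (snd p)) \<and>
     (\<forall>x\<in>verts Q. \<exists>N. \<forall>u l.
        is_path Q (u, l) \<and> x \<in> set (pre_digraph.awalk_verts Q u l) \<and> \<not> in_ideal K Q \<rho> (u, l)
        \<longrightarrow> length l \<le> N)"


section \<open>Representations of a bound quiver\<close>

text \<open>
  A representation is given by a family of subspaces of an ambient space \<open>'b \<Rightarrow> 'k\<close> whose sum is
  direct, so that the associated module over the bound path algebra is that sum. A path acts by
  letting its arrows act in order.
\<close>

record ('q, 'a, 'v) rep =
  rep_space :: "'q \<Rightarrow> 'v set"
  rep_action :: "'a \<Rightarrow> 'v \<Rightarrow> 'v"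

definition rep_total :: "('q, 'a) pre_digraph \<Rightarrow> ('q, 'a, 'b \<Rightarrow> 'k::field) rep \<Rightarrow> ('b \<Rightarrow> 'k) set" where
  "rep_total Q M = module.span vscale (\<Union>x\<in>verts Q. rep_space M x)"

definition linear_between ::
  "('b \<Rightarrow> 'k::field) set \<Rightarrow> ('c \<Rightarrow> 'k) set \<Rightarrow> (('b \<Rightarrow> 'k) \<Rightarrow> 'c \<Rightarrow> 'k) \<Rightarrow> bool" where
  "linear_between V W f \<longleftrightarrow>
     (\<forall>v\<in>V. f v \<in> W) \<and> (\<forall>u\<in>V. \<forall>v\<in>V. f (u + v) = f u + f v) \<and>
     (\<forall>c. \<forall>v\<in>V. f (vscale c v) = vscale c (f v))"

definition representation ::
  "('q, 'a) pre_digraph \<Rightarrow> ('q, 'a) path set \<Rightarrow> ('q, 'a, 'b \<Rightarrow> 'k::field) rep \<Rightarrow> bool" where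
  "representation Q \<rho> M \<longleftrightarrow>
     (\<forall>x\<in>verts Q. module.subspace vscale (rep_space M x)) \<and>
     (\<forall>X u. finite X \<and> X \<subseteq> verts Q \<and> (\<forall>x\<in>X. u x \<in> rep_space M x) \<and> sum u X = 0 \<longrightarrow> (\<forall>x\<in>X. u x = 0)) \<and>
     (\<exists>B. finite B \<and> rep_total Q M = module.span vscale B) \<and>
     (\<forall>\<gamma>\<in>arcs Q. linear_between (rep_space M (tail Q \<gamma>)) (rep_space M (head Q \<gamma>)) (rep_action M \<gamma>)) \<and>
     (\<forall>(x, l)\<in>\<rho>. \<forall>v\<in>rep_space M x. fold (rep_action M) l v = 0)"

text \<open>
  Modules over \<open>KQ/\<langle>\<rho>\<rangle>\<close> are the representations of \<open>Q\<close> on which \<open>\<rho>\<close> vanishes, and they form a full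
  subcategory, so \<open>\<rho>\<close> does not enter the homomorphisms. A homomorphism is a linear map of the total
  spaces, normalized to be \<open>0\<close> outside the domain so that it is determined by its values there.
\<close>

definition rep_hom ::
  "('q, 'a) pre_digraph \<Rightarrow> ('q, 'a, 'b \<Rightarrow> 'k::field) rep \<Rightarrow> ('q, 'a, 'c \<Rightarrow> 'k) rep
    \<Rightarrow> (('b \<Rightarrow> 'k) \<Rightarrow> 'c \<Rightarrow> 'k) set" where
  "rep_hom Q M N = {f.
     linear_between (rep_total Q M) (rep_total Q N) f \<and>
     (\<forall>v. v \<notin> rep_total Q M \<longrightarrow> f v = 0) \<and>
     (\<forall>x\<in>verts Q. \<forall>v\<in>rep_space M x. f v \<in> rep_space N x) \<and>
     (\<forall>\<gamma>\<in>arcs Q. \<forall>v\<in>rep_space M (tail Q \<gamma>). f (rep_action M \<gamma> v) = rep_action N \<gamma> (f v))}"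

definition map_scale :: "'k::times \<Rightarrow> ('v \<Rightarrow> 'c \<Rightarrow> 'k) \<Rightarrow> 'v \<Rightarrow> 'c \<Rightarrow> 'k" where
  "map_scale c f = (\<lambda>v. vscale c (f v))"


section \<open>Rooted tree modules\<close>

text \<open>
  A cycle of the underlying undirected multigraph: loops, and pairs of arrows with the same two
  endpoints in either orientation, count as cycles. (The notion of forest in the library only
  excludes directed cycles.)
\<close>

definition undirected_cycle :: "('n, 'e) pre_digraph \<Rightarrow> 'n list \<Rightarrow> 'e list \<Rightarrow> bool" where
  "undirected_cycle T vs es \<longleftrightarrow>
     es \<noteq> [] \<and> length vs = length es \<and> distinct vs \<and> distinct es \<and> set es \<subseteq> arcs T \<and>
     (\<forall>i<length es. {tail T (es ! i), head T (es ! i)} = {vs ! i, vs ! (Suc i mod length es)})"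

definition quiver_tree :: "('n, 'e) pre_digraph \<Rightarrow> bool" where
  "quiver_tree T \<longleftrightarrow> fin_digraph T \<and> connected T \<and> \<not> (\<exists>vs es. undirected_cycle T vs es)"

definition rooted_tree :: "('n, 'e) pre_digraph \<Rightarrow> bool" where
  "rooted_tree T \<longleftrightarrow> quiver_tree T \<and> (\<exists>!r. r \<in> verts T \<and> in_arcs T r = {})"

record ('n, 'e, 'q, 'a) quiver_map =
  on_vert :: "'n \<Rightarrow> 'q"
  on_arr :: "'e \<Rightarrow> 'a"

definition quiver_morphism ::
  "('n, 'e) pre_digraph \<Rightarrow> ('q, 'a) pre_digraph \<Rightarrow> ('n, 'e, 'q, 'a) quiver_map \<Rightarrow> bool" where
  "quiver_morphism T Q F \<longleftrightarrow>
     (\<forall>n\<in>verts T. on_vert F n \<in> verts Q) \<and>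
     (\<forall>a\<in>arcs T. on_arr F a \<in> arcs Q \<and> tail Q (on_arr F a) = on_vert F (tail T a) \<and>
        head Q (on_arr F a) = on_vert F (head T a))"

definition map_path :: "('n, 'e, 'q, 'a) quiver_map \<Rightarrow> ('n, 'e) path \<Rightarrow> ('q, 'a) path" where
  "map_path F p = (on_vert F (fst p), map (on_arr F) (snd p))"

definition bound_morphism ::
  "'k::field itself \<Rightarrow> ('n, 'e) pre_digraph \<Rightarrow> ('q, 'a) pre_digraph \<Rightarrow> ('q, 'a) path set
    \<Rightarrow> ('n, 'e, 'q, 'a) quiver_map \<Rightarrow> bool" where
  "bound_morphism K T Q \<rho> F \<longleftrightarrow>
     quiver_morphism T Q F \<and> \<not> (\<exists>p. is_path T p \<and> in_ideal K Q \<rho> (map_path F p))"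

definition rooted_tree_over ::
  "'k::field itself \<Rightarrow> ('q, 'a) pre_digraph \<Rightarrow> ('q, 'a) path set
    \<Rightarrow> ('n, 'e) pre_digraph \<Rightarrow> ('n, 'e, 'q, 'a) quiver_map \<Rightarrow> bool" where
  "rooted_tree_over K Q \<rho> T F \<longleftrightarrow> rooted_tree T \<and> bound_morphism K T Q \<rho> F"

text \<open>
  The space with basis \<open>T\<^sub>0\<close>, as the functions vanishing off \<open>T\<^sub>0\<close>; the basis vector at \<open>n\<close> is
  \<open>basis_elem n\<close>.
\<close>

definition tree_space :: "('n, 'e) pre_digraph \<Rightarrow> ('n \<Rightarrow> 'k::field) set" where
  "tree_space T = {v. \<forall>n. v n \<noteq> 0 \<longrightarrow> n \<in> verts T}"

definition tree_module ::
  "('n, 'e) pre_digraph \<Rightarrow> ('n, 'e, 'q, 'a) quiver_map \<Rightarrow> ('q, 'a, 'n \<Rightarrow> 'k::field) rep" where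
  "tree_module T F = \<lparr>
     rep_space = (\<lambda>x. {v \<in> tree_space T. \<forall>n. v n \<noteq> 0 \<longrightarrow> on_vert F n = x}),
     rep_action = (\<lambda>\<gamma> v. \<Sum>n\<in>verts T.
       vscale (v n) (\<Sum>a\<in>{a \<in> arcs T. tail T a = n \<and> on_arr F a = \<gamma>}. basis_elem (head T a))) \<rparr>"


section \<open>Networks and traversals\<close>

record ('v, 'e) network =
  quiver :: "('v, 'e) pre_digraph"
  edges :: "'v set set"

definition is_network :: "('v, 'e) network \<Rightarrow> bool" where
  "is_network N \<longleftrightarrow> wf_digraph (quiver N) \<and> (\<forall>e\<in>edges N. e \<subseteq> verts (quiver N) \<and> card e = 2)"

definition subnetwork :: "('v, 'e) network \<Rightarrow> ('v, 'e) network \<Rightarrow> bool" where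
  "subnetwork M N \<longleftrightarrow>
     is_network M \<and> is_network N \<and> subgraph (quiver M) (quiver N) \<and> edges M \<subseteq> edges N"

datatype ('v, 'e) link = Arrow 'e | Inverse 'e | Edge "'v set"

fun link_inv :: "('v, 'e) link \<Rightarrow> ('v, 'e) link" where
  "link_inv (Arrow a) = Inverse a"
| "link_inv (Inverse a) = Arrow a"
| "link_inv (Edge e) = Edge e"

fun joins :: "('v, 'e) network \<Rightarrow> ('v, 'e) link \<Rightarrow> 'v \<Rightarrow> 'v \<Rightarrow> bool" where
  "joins N (Arrow a) u v \<longleftrightarrow> a \<in> arcs (quiver N) \<and> tail (quiver N) a = u \<and> head (quiver N) a = v"
| "joins N (Inverse a) u v \<longleftrightarrow> a \<in> arcs (quiver N) \<and> head (quiver N) a = u \<and> tail (quiver N) a = v"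
| "joins N (Edge e) u v \<longleftrightarrow> e \<in> edges N \<and> e = {u, v}"

fun link_walk :: "('v, 'e) network \<Rightarrow> 'v \<Rightarrow> ('v, 'e) link list \<Rightarrow> 'v \<Rightarrow> bool" where
  "link_walk N u [] w \<longleftrightarrow> u \<in> verts (quiver N) \<and> u = w"
| "link_walk N u (l # ls) w \<longleftrightarrow> (\<exists>v. joins N l u v \<and> link_walk N v ls w)"

definition traversal :: "('v, 'e) network \<Rightarrow> 'v \<Rightarrow> ('v, 'e) link list \<Rightarrow> 'v \<Rightarrow> bool" where
  "traversal N u ls w \<longleftrightarrow> link_walk N u ls w \<and> successively (\<lambda>l l'. l' \<noteq> link_inv l) ls"

text \<open>A traversal is determined by its starting vertex and its links.\<close>

definition traversals :: "('v, 'e) network \<Rightarrow> ('v \<times> ('v, 'e) link list) set" where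
  "traversals N = {(u, ls). \<exists>w. traversal N u ls w}"

definition triangle :: "('v, 'e) network \<Rightarrow> 'v set \<Rightarrow> bool" where
  "triangle N X \<longleftrightarrow>
     X \<subseteq> verts (quiver N) \<and> card X = 3 \<and>
     card (arcs (quiver N \<restriction> X)) + card {e \<in> edges N. e \<subseteq> X} = 3"

definition connected_network :: "('v, 'e) network \<Rightarrow> bool" where
  "connected_network M \<longleftrightarrow>
     (\<forall>u\<in>verts (quiver M). \<forall>v\<in>verts (quiver M). \<exists>ls. traversal M u ls v)"


section \<open>The pullback network and the 2-covering network\<close>

text \<open>
  A non-root vertex \<open>n\<close> is written as the head of the unique arrow \<open>a\<^sub>n\<close> ending there, its parent as
  the tail of that arrow.
\<close>

definition pullback_network ::
  "('n, 'e) pre_digraph \<Rightarrow> ('n, 'e, 'q, 'a) quiver_map \<Rightarrow> ('m, 'f) pre_digraph \<Rightarrow> ('m, 'f, 'q, 'a) quiver_map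
    \<Rightarrow> ('n \<times> 'm, 'e \<times> 'f) network" where
  "pullback_network T1 F1 T2 F2 =
     (let V = {(n, m). n \<in> verts T1 \<and> m \<in> verts T2 \<and> on_vert F1 n = on_vert F2 m} in
      \<lparr> quiver = \<lparr>
          verts = V,
          arcs = {(a, b). a \<in> arcs T1 \<and> b \<in> arcs T2 \<and> on_arr F1 a = on_arr F2 b},
          tail = (\<lambda>(a, b). (tail T1 a, tail T2 b)),
          head = (\<lambda>(a, b). (head T1 a, head T2 b)) \<rparr>,
        edges = {{(head T1 a, m), (head T1 a', m)} | a a' m.
          a \<in> arcs T1 \<and> a' \<in> arcs T1 \<and> head T1 a \<noteq> head T1 a' \<and> tail T1 a = tail T1 a' \<and>
          on_arr F1 a = on_arr F1 a' \<and> (head T1 a, m) \<in> V \<and> (head T1 a', m) \<in> V} \<rparr>)"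

definition covering_network ::
  "('n, 'e) pre_digraph \<Rightarrow> ('n, 'e, 'q, 'a) quiver_map \<Rightarrow> ('m, 'f) pre_digraph \<Rightarrow> ('m, 'f, 'q, 'a) quiver_map
    \<Rightarrow> ('n \<times> 'm \<times> int, 'e \<times> 'f \<times> int) network" where
  "covering_network T1 F1 T2 F2 =
     (let N = pullback_network T1 F1 T2 F2 in
      \<lparr> quiver = \<lparr>
          verts = {(n, m, i). (n, m) \<in> verts (quiver N) \<and> i \<in> {-1, 1}},
          arcs = {(a, b, i). (a, b) \<in> arcs (quiver N) \<and> i \<in> {-1, 1}},
          tail = (\<lambda>(a, b, i). (tail T1 a, tail T2 b, i)),
          head = (\<lambda>(a, b, i). (head T1 a, head T2 b, i)) \<rparr>,
        edges = {{(n, m, i), (n', m, -i)} | n n' m i.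
          {(n, m), (n', m)} \<in> edges N \<and> i \<in> {-1, 1}} \<rparr>)"

definition proj :: "'x \<times> 'y \<times> int \<Rightarrow> 'x \<times> 'y" where
  "proj = (\<lambda>(x, y, i). (x, y))"

fun proj_link :: "('n \<times> 'm \<times> int, 'e \<times> 'f \<times> int) link \<Rightarrow> ('n \<times> 'm, 'e \<times> 'f) link" where
  "proj_link (Arrow a) = Arrow (proj a)"
| "proj_link (Inverse a) = Inverse (proj a)"
| "proj_link (Edge e) = Edge (proj ` e)"

definition triangle_traversals1 ::
  "('n, 'e) pre_digraph \<Rightarrow> ('n, 'e, 'q, 'a) quiver_map \<Rightarrow> ('m, 'f) pre_digraph \<Rightarrow> ('m, 'f, 'q, 'a) quiver_map
    \<Rightarrow> (('n \<times> 'm) \<times> ('n \<times> 'm, 'e \<times> 'f) link list) set" where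
  "triangle_traversals1 T1 F1 T2 F2 =
     (let N = pullback_network T1 F1 T2 F2 in
      {(u, [l, l']) | u l l'. \<exists>v w. joins N l u v \<and> joins N l' v w \<and>
         (u, [l, l']) \<in> traversals N \<and> triangle N {u, v, w}})"

definition triangle_traversals2 ::
  "('n, 'e) pre_digraph \<Rightarrow> ('n, 'e, 'q, 'a) quiver_map \<Rightarrow> ('m, 'f) pre_digraph \<Rightarrow> ('m, 'f, 'q, 'a) quiver_map
    \<Rightarrow> (('n \<times> 'm \<times> int) \<times> ('n \<times> 'm \<times> int, 'e \<times> 'f \<times> int) link list) set" where
  "triangle_traversals2 T1 F1 T2 F2 =
     {(u, ls) \<in> traversals (covering_network T1 F1 T2 F2).
        (proj u, map proj_link ls) \<in> triangle_traversals1 T1 F1 T2 F2}"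


section \<open>Generalized graph maps and ghosts\<close>

definition involution_free :: "('n \<times> 'm \<times> int, 'e \<times> 'f \<times> int) network \<Rightarrow> bool" where
  "involution_free M \<longleftrightarrow>
     (\<forall>n m j. (n, m, j) \<in> verts (quiver M) \<longrightarrow> (n, m, -j) \<notin> verts (quiver M))"

definition complete_network ::
  "('n, 'e) pre_digraph \<Rightarrow> ('n, 'e, 'q, 'a) quiver_map \<Rightarrow> ('m, 'f) pre_digraph
    \<Rightarrow> ('n \<times> 'm \<times> int, 'e \<times> 'f \<times> int) network \<Rightarrow> bool" where
  "complete_network T1 F1 T2 M \<longleftrightarrow>
     (\<forall>(n, m, j)\<in>verts (quiver M).
        (\<forall>a\<in>arcs T1. head T1 a = n \<longrightarrow>
           (\<exists>b\<in>arcs T2. head T2 b = m \<and> (a, b, j) \<in> arcs (quiver M)) \<or>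
           (\<exists>a'\<in>arcs T1. tail T1 a' = tail T1 a \<and> on_arr F1 a = on_arr F1 a' \<and>
              (head T1 a', m, -j) \<in> verts (quiver M) \<and>
              {(n, m, j), (head T1 a', m, -j)} \<in> edges M)) \<and>
        (\<forall>b\<in>arcs T2. tail T2 b = m \<longrightarrow>
           (\<exists>a\<in>arcs T1. tail T1 a = n \<and> (a, b, j) \<in> arcs (quiver M))))"

definition complete_connected_free ::
  "('n, 'e) pre_digraph \<Rightarrow> ('n, 'e, 'q, 'a) quiver_map \<Rightarrow> ('m, 'f) pre_digraph \<Rightarrow> ('m, 'f, 'q, 'a) quiver_map
    \<Rightarrow> ('n \<times> 'm \<times> int, 'e \<times> 'f \<times> int) network \<Rightarrow> bool" where
  "complete_connected_free T1 F1 T2 F2 M \<longleftrightarrow>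
     subnetwork M (covering_network T1 F1 T2 F2) \<and> verts (quiver M) \<noteq> {} \<and>
     complete_network T1 F1 T2 M \<and> connected_network M \<and>
     traversals M \<inter> triangle_traversals2 T1 F1 T2 F2 = {}"

definition generalized_graph_map ::
  "('n, 'e) pre_digraph \<Rightarrow> ('n, 'e, 'q, 'a) quiver_map \<Rightarrow> ('m, 'f) pre_digraph \<Rightarrow> ('m, 'f, 'q, 'a) quiver_map
    \<Rightarrow> ('n \<times> 'm \<times> int, 'e \<times> 'f \<times> int) network \<Rightarrow> bool" where
  "generalized_graph_map T1 F1 T2 F2 M \<longleftrightarrow>
     complete_connected_free T1 F1 T2 F2 M \<and> involution_free M"

text \<open>
  The linear extension to the space of \<open>T1\<close> of \<open>v\<^sub>n \<mapsto> \<Sum> j w\<^sub>m\<close>, the sum ranging over the vertices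
  \<open>(n, m, j)\<close> of the subnetwork; \<open>0\<close> outside that space, as for \<^const>\<open>rep_hom\<close>.
\<close>

definition associated_map ::
  "('n, 'e) pre_digraph \<Rightarrow> ('n \<times> 'm \<times> int, 'e \<times> 'f \<times> int) network \<Rightarrow> ('n \<Rightarrow> 'k::field) \<Rightarrow> 'm \<Rightarrow> 'k" where
  "associated_map T1 M v =
     (if v \<in> tree_space T1
      then \<Sum>n\<in>verts T1. vscale (v n)
        (\<Sum>(n', m, j)\<in>{x \<in> verts (quiver M). fst x = n}. vscale (of_int j) (basis_elem m))
      else 0)"

definition ghost ::
  "'k::field itself \<Rightarrow> ('n, 'e) pre_digraph \<Rightarrow> ('n, 'e, 'q, 'a) quiver_map \<Rightarrow> ('m, 'f) pre_digraph
    \<Rightarrow> ('m, 'f, 'q, 'a) quiver_map \<Rightarrow> ('n \<times> 'm \<times> int, 'e \<times> 'f \<times> int) network \<Rightarrow> bool" where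
  "ghost _ T1 F1 T2 F2 M \<longleftrightarrow>
     complete_connected_free T1 F1 T2 F2 M \<and>
     (associated_map T1 M :: ('n \<Rightarrow> 'k) \<Rightarrow> 'm \<Rightarrow> 'k) = 0"

definition ghost_free ::
  "'k::field itself \<Rightarrow> ('n, 'e) pre_digraph \<Rightarrow> ('n, 'e, 'q, 'a) quiver_map \<Rightarrow> ('m, 'f) pre_digraph
    \<Rightarrow> ('m, 'f, 'q, 'a) quiver_map \<Rightarrow> bool" where
  "ghost_free K T1 F1 T2 F2 \<longleftrightarrow> \<not> (\<exists>M. ghost K T1 F1 T2 F2 M)"


section \<open>Well-definedness\<close>

lemma vector_space_vscale: "vector_space (vscale :: 'k::field \<Rightarrow> ('b \<Rightarrow> 'k) \<Rightarrow> 'b \<Rightarrow> 'k)"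
  by unfold_locales (auto simp: vscale_def fun_eq_iff algebra_simps)

lemma vector_space_map_scale:
  "vector_space (map_scale :: 'k::field \<Rightarrow> ('v \<Rightarrow> 'c \<Rightarrow> 'k) \<Rightarrow> 'v \<Rightarrow> 'c \<Rightarrow> 'k)"
  by unfold_locales (auto simp: map_scale_def vscale_def fun_eq_iff algebra_simps)

lemma sum_fun_apply: "sum f A x = (\<Sum>i\<in>A. f i x)"
  for f :: "'i \<Rightarrow> 'b \<Rightarrow> 'k::comm_monoid_add"
  by (induction A rule: infinite_finite_induct) auto

lemma is_network_pullback:
  assumes "wf_digraph T1" "wf_digraph T2" "quiver_morphism T1 Q F1" "quiver_morphism T2 Q F2"
  shows "is_network (pullback_network T1 F1 T2 F2)"
proof -
  interpret A: wf_digraph T1 by fact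
  interpret B: wf_digraph T2 by fact
  show ?thesis
    using assms(3,4)
    by (fastforce simp: is_network_def pullback_network_def quiver_morphism_def Let_def
        intro!: wf_digraph.intro)
qed

lemma is_network_covering:
  assumes "wf_digraph T1" "wf_digraph T2" "quiver_morphism T1 Q F1" "quiver_morphism T2 Q F2"
  shows "is_network (covering_network T1 F1 T2 F2)"
proof -
  have *: "wf_digraph (quiver (pullback_network T1 F1 T2 F2))"
    "\<And>e. e \<in> edges (pullback_network T1 F1 T2 F2) \<Longrightarrow>
       e \<subseteq> verts (quiver (pullback_network T1 F1 T2 F2))"
    using is_network_pullback[OF assms] by (auto simp: is_network_def)
  have "wf_digraph (quiver (covering_network T1 F1 T2 F2))"
    using wf_digraph.tail_in_verts[OF *(1)] wf_digraph.head_in_verts[OF *(1)]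
    by (fastforce simp: covering_network_def pullback_network_def Let_def intro!: wf_digraph.intro)
  moreover have "e \<subseteq> verts (quiver (covering_network T1 F1 T2 F2)) \<and> card e = 2"
    if e: "e \<in> edges (covering_network T1 F1 T2 F2)" for e
  proof -
    obtain n n' m i where "e = {(n, m, i), (n', m, -i)}" "i \<in> {-1, 1}"
      "{(n, m), (n', m)} \<in> edges (pullback_network T1 F1 T2 F2)"
      using e by (auto simp: covering_network_def Let_def)
    then show ?thesis
      using *(2)[of "{(n, m), (n', m)}"] by (auto simp: covering_network_def Let_def)
  qed
  ultimately show ?thesis
    by (simp add: is_network_def)
qed

lemma subspace_supported:
  "module.subspace vscale {v :: 'b \<Rightarrow> 'k::field. \<forall>n. v n \<noteq> 0 \<longrightarrow> P n}"
proof -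
  interpret V: vector_space "vscale :: 'k \<Rightarrow> ('b \<Rightarrow> 'k) \<Rightarrow> 'b \<Rightarrow> 'k"
    by (rule vector_space_vscale)
  have "{v :: 'b \<Rightarrow> 'k. \<forall>n. v n \<noteq> 0 \<longrightarrow> P n} = {v. \<forall>n. \<not> P n \<longrightarrow> v n = 0}"
    by blast
  then show ?thesis
    by (simp add: V.subspace_def vscale_def)
qed

lemma subspace_tree_space: "module.subspace vscale (tree_space T :: ('n \<Rightarrow> 'k::field) set)"
  unfolding tree_space_def by (rule subspace_supported)

lemma tree_space_span:
  assumes "finite (verts T)"
  shows "tree_space T = module.span vscale (basis_elem ` verts T :: ('n \<Rightarrow> 'k::field) set)"
proof -
  interpret V: vector_space "vscale :: 'k \<Rightarrow> ('n \<Rightarrow> 'k) \<Rightarrow> 'n \<Rightarrow> 'k"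
    by (rule vector_space_vscale)
  have "V.subspace (tree_space T)"
    by (rule subspace_tree_space)
  moreover have "basis_elem ` verts T \<subseteq> (tree_space T :: ('n \<Rightarrow> 'k) set)"
    by (auto simp: tree_space_def basis_elem_def split: if_splits)
  ultimately have "V.span (basis_elem ` verts T) \<subseteq> tree_space T"
    by (rule V.span_minimal[rotated])
  moreover have "v \<in> V.span (basis_elem ` verts T)" if v: "v \<in> tree_space T" for v
  proof -
    have "v = (\<Sum>n\<in>verts T. vscale (v n) (basis_elem n))"
    proof
      fix x
      have "(\<Sum>n\<in>verts T. v n * basis_elem n x) = (\<Sum>n\<in>verts T. if n = x then v x else 0)"
        by (intro sum.cong) (auto simp: basis_elem_def)
      then show "v x = (\<Sum>n\<in>verts T. vscale (v n) (basis_elem n)) x"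
        using v assms by (auto simp: sum_fun_apply vscale_def tree_space_def)
    qed
    moreover have "(\<Sum>n\<in>verts T. vscale (v n) (basis_elem n)) \<in> V.span (basis_elem ` verts T)"
      by (intro V.span_sum V.span_scale V.span_base) auto
    ultimately show ?thesis by simp
  qed
  ultimately show ?thesis by blast
qed

lemma rep_total_tree_module:
  assumes "finite (verts T)" "quiver_morphism T Q F"
  shows "rep_total Q (tree_module T F) = (tree_space T :: ('n \<Rightarrow> 'k::field) set)"
proof -
  interpret V: vector_space "vscale :: 'k \<Rightarrow> ('n \<Rightarrow> 'k) \<Rightarrow> 'n \<Rightarrow> 'k"
    by (rule vector_space_vscale)
  have sub: "V.subspace (tree_space T)"
    by (rule subspace_tree_space)
  have "basis_elem ` verts T \<subseteq> (\<Union>x\<in>verts Q. rep_space (tree_module T F) x :: ('n \<Rightarrow> 'k) set)"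
    using assms(2)
    by (auto simp: tree_module_def tree_space_def basis_elem_def quiver_morphism_def split: if_splits)
  then have "tree_space T \<subseteq> (rep_total Q (tree_module T F) :: ('n \<Rightarrow> 'k) set)"
    unfolding rep_total_def tree_space_span[OF assms(1)] by (rule V.span_mono)
  moreover have "rep_total Q (tree_module T F) \<subseteq> (tree_space T :: ('n \<Rightarrow> 'k) set)"
    unfolding rep_total_def by (rule V.span_minimal[OF _ sub]) (auto simp: tree_module_def)
  ultimately show ?thesis by blast
qed

lemma rep_action_nonzero:
  assumes "rep_action (tree_module T F) \<gamma> v m \<noteq> (0::'k::field)"
  shows "\<exists>a\<in>arcs T. head T a = m \<and> on_arr F a = \<gamma> \<and> v (tail T a) \<noteq> 0 \<and> tail T a \<in> verts T"
proof -
  have "(\<Sum>n\<in>verts T. v n * (\<Sum>a\<in>{a \<in> arcs T. tail T a = n \<and> on_arr F a = \<gamma>}.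
      basis_elem (head T a) m)) \<noteq> 0"
    using assms by (simp add: tree_module_def sum_fun_apply vscale_def)
  then obtain n where n: "n \<in> verts T"
    "v n * (\<Sum>a\<in>{a \<in> arcs T. tail T a = n \<and> on_arr F a = \<gamma>}. basis_elem (head T a) m) \<noteq> 0"
    by (rule sum.not_neutral_contains_not_neutral)
  then have "(\<Sum>a\<in>{a \<in> arcs T. tail T a = n \<and> on_arr F a = \<gamma>}. basis_elem (head T a) m) \<noteq> (0::'k)"
    by auto
  then obtain a where "a \<in> {a \<in> arcs T. tail T a = n \<and> on_arr F a = \<gamma>}"
    "basis_elem (head T a) m \<noteq> (0::'k)"
    by (rule sum.not_neutral_contains_not_neutral)
  with n show ?thesis
    by (auto simp: basis_elem_def split: if_splits)
qed

lemma fold_rep_action_nonzero: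
  assumes "wf_digraph T" "v \<in> tree_space T"
    and "fold (rep_action (tree_module T F)) l v m \<noteq> (0::'k::field)"
  shows "\<exists>n p. v n \<noteq> 0 \<and> pre_digraph.awalk T n p m \<and> map (on_arr F) p = l"
  using assms(2,3)
proof (induction l arbitrary: v)
  case Nil
  then show ?case
    by (auto simp: tree_space_def pre_digraph.awalk_def pre_digraph.cas.simps)
next
  case (Cons \<gamma> l)
  interpret wf_digraph T by fact
  have "rep_action (tree_module T F) \<gamma> v \<in> tree_space T"
    using rep_action_nonzero[of T F \<gamma> v] by (fastforce simp: tree_space_def)
  from Cons.IH[OF this] Cons.prems obtain n p where np:
    "rep_action (tree_module T F) \<gamma> v n \<noteq> 0" "awalk n p m" "map (on_arr F) p = l"
    by auto
  from rep_action_nonzero[OF np(1)] obtain a where a: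
    "a \<in> arcs T" "head T a = n" "on_arr F a = \<gamma>" "v (tail T a) \<noteq> 0" by blast
  then have "awalk (tail T a) (a # p) m"
    using np(2) by (auto simp: awalk_Cons_iff)
  with a np(3) show ?case by force
qed

lemma linear_rep_action:
  "rep_action (tree_module T F) \<gamma> (u + v) = rep_action (tree_module T F) \<gamma> u + rep_action (tree_module T F) \<gamma> v"
  "rep_action (tree_module T F) \<gamma> (vscale c v) = vscale (c::'k::field) (rep_action (tree_module T F) \<gamma> v)"
  by (auto simp: tree_module_def fun_eq_iff sum_fun_apply vscale_def algebra_simps sum.distrib
      sum_distrib_left)

theorem representation_tree_module:
  assumes "bound_quiver TYPE('k) Q \<rho>" "rooted_tree_over TYPE('k) Q \<rho> T F"
  shows "representation Q \<rho> (tree_module T F :: ('q, 'a, 'n \<Rightarrow> 'k::field) rep)"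
proof -
  interpret V: vector_space "vscale :: 'k \<Rightarrow> ('n \<Rightarrow> 'k) \<Rightarrow> 'n \<Rightarrow> 'k"
    by (rule vector_space_vscale)
  let ?M = "tree_module T F :: ('q, 'a, 'n \<Rightarrow> 'k) rep"
  have "fin_digraph T" and F: "quiver_morphism T Q F"
    and bound: "\<And>p. is_path T p \<Longrightarrow> \<not> in_ideal TYPE('k) Q \<rho> (map_path F p)"
    using assms(2)
    by (auto simp: rooted_tree_over_def rooted_tree_def quiver_tree_def bound_morphism_def)
  interpret fin_digraph T by fact
  have "V.subspace (rep_space ?M x)" for x
  proof -
    have "rep_space ?M x = {v. \<forall>n. v n \<noteq> 0 \<longrightarrow> n \<in> verts T \<and> on_vert F n = x}"
      by (auto simp: tree_module_def tree_space_def)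
    then show ?thesis
      by (simp only: subspace_supported)
  qed
  moreover have "u x = 0"
    if "finite X" "\<forall>x\<in>X. u x \<in> rep_space ?M x" "sum u X = 0" "x \<in> X" for X u x
  proof
    fix n
    show "u x n = 0 n"
    proof (cases "on_vert F n = x")
      case True
      have "(\<Sum>y\<in>X. u y n) = (\<Sum>y\<in>X. if y = x then u x n else 0)"
        using that(2) True by (intro sum.cong) (auto simp: tree_module_def)
      then show ?thesis
        using that by (auto simp: sum_fun_apply fun_eq_iff)
    next
      case False
      then show ?thesis
        using that by (auto simp: tree_module_def)
    qed
  qed
  moreover have "\<exists>B. finite B \<and> rep_total Q ?M = V.span B"
    using rep_total_tree_module[OF _ F] tree_space_span[of T] finite_verts by (metis finite_imageI)
  moreover have "rep_action ?M \<gamma> v \<in> rep_space ?M (head Q \<gamma>)" for \<gamma> v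
  proof -
    have "m \<in> verts T \<and> on_vert F m = head Q \<gamma>" if "rep_action ?M \<gamma> v m \<noteq> 0" for m
      using rep_action_nonzero[OF that] F by (auto simp: quiver_morphism_def)
    then show ?thesis
      by (simp add: tree_module_def tree_space_def)
  qed
  moreover have "fold (rep_action ?M) l v = 0" if l: "(x, l) \<in> \<rho>" and v: "v \<in> rep_space ?M x" for x l v
  proof (rule ccontr)
    assume "fold (rep_action ?M) l v \<noteq> 0"
    then obtain m where "fold (rep_action ?M) l v m \<noteq> 0"
      by (auto simp: fun_eq_iff)
    moreover have "v \<in> tree_space T"
      using v by (simp add: tree_module_def)
    ultimately obtain n p where np: "v n \<noteq> 0" "awalk n p m" "map (on_arr F) p = l"
      using fold_rep_action_nonzero[OF wf_digraph_axioms] by blast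
    then have "map_path F (n, p) = (x, l)"
      using v by (auto simp: map_path_def tree_module_def)
    moreover have "is_path T (n, p)"
      using np(2) by (auto simp: is_path_def)
    ultimately show False
      using bound[of "(n, p)"] l by (auto simp: in_ideal_def intro: path_ideal.gen)
  qed
  ultimately show ?thesis
    unfolding representation_def linear_between_def by (auto simp: linear_rep_action)
qed

end

theory Submission
  imports Defs
begin

text \<open>
  In either tree every vertex has at most one incoming arrow, so a homomorphism is a matrix \<open>h\<close>
  indexed by the vertices of the pullback network such that, for all \<open>n\<close>, \<open>m\<close> and every colour of arrows, the
  sum of \<open>h(n', m)\<close> over the children \<open>n'\<close> of \<open>n\<close> along that colour equals \<open>h(n, p(m))\<close> if the arrow ending
  at \<open>m\<close> has that colour, and \<open>0\<close> otherwise. The pairs occurring in one such equation form a clique of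
  the pullback network. Completeness and the absence of triangles say that a network matches its
  vertices in each clique perfectly; since the edges of the matching change the sign, the
  associated map satisfies the equations. A connected network of this kind grows downwards from
  a single vertex or a single edge, hence its associated map is nonzero. Conversely, from a point of the
  support of \<open>h\<close> with \<open>m\<close> minimal one can descend inside the support and obtain a generalized graph
  map, a multiple of which is subtracted from \<open>h\<close> to make the support smaller.
\<close>

section \<open>Arborescences\<close>

text \<open>A vertex \<open>(n, m)\<close> lies in one clique upwards, with its siblings and its
  parent, unless \<open>n\<close> is a root, and in one clique downwards for every arrow of
  \<open>T2\<close> leaving \<open>m\<close>. Completeness supplies a link of the network in each of
  these cliques, and the absence of triangles forbids a second one. A vertex entered by an arrow has
  thereby used up its upper clique and carries no edge. In a connected network this confines the
  edges to the vertices over a minimal \<open>m\<close>, which is why the network can only grow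
  downwards from there. Triangles have to be tested after forgetting the sign: each has one or three
  edges, every edge changes the sign, so no triangle closes up in the 2-covering. The unique
  incoming arrow is not part of the definition of a rooted tree. A second one would yield two walks
  from the only source with different last arrows, and these close up to an undirected
  cycle.\<close>

context wf_digraph begin

lemma awalk_chain:
  assumes "awalk u p v"
  shows "Suc i < length p \<Longrightarrow> head G (p ! i) = tail G (p ! Suc i)"
    and "p \<noteq> [] \<Longrightarrow> tail G (p ! 0) = u"
    and "p \<noteq> [] \<Longrightarrow> head G (p ! (length p - 1)) = v"
  using assms
proof (induction p arbitrary: u i)
  case (Cons e p)
  { case 1 with Cons show ?case by (cases i; cases p) (auto simp: awalk_Cons_iff) }
  { case 2 with Cons show ?case by (auto simp: awalk_Cons_iff) }
  { case 3 with Cons show ?case by (cases p) (auto simp: awalk_Cons_iff awalk_simps) }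
qed auto

text \<open>The arrows of a directed cycle have distinct tails, and the head of each is the tail of
  the next one modulo the length, so the tails serve as the vertex list. A loop gives lists of
  length one.\<close>

lemma cycle_imp_undirected_cycle:
  assumes "cycle p"
  shows "\<exists>vs es. undirected_cycle G vs es"
proof -
  obtain u where u: "awalk u p u" "distinct (tl (awalk_verts u p))" "p \<noteq> []"
    using assms by (auto simp: cycle_def)
  have "awalk_verts u p = map (tail G) p @ [head G (last p)]"
    using u by (simp add: awalk_verts_conv)
  then have "distinct (map (tail G) p)"
    using u awalk_chain[OF u(1)] by (cases p) (auto simp: last_conv_nth)
  moreover have "map (tail G) p ! (Suc i mod length p) = head G (p ! i)" if "i < length p" for i
  proof (cases "Suc i < length p")
    case True then show ?thesis using awalk_chain(1)[OF u(1)] by simp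
  next
    case False
    then have "Suc i = length p" using that by simp
    then show ?thesis using awalk_chain(2,3)[OF u(1)] u(3) by (auto simp flip: \<open>Suc i = length p\<close>)
  qed
  ultimately have "undirected_cycle G (map (tail G) p) p"
    using u by (auto simp: undirected_cycle_def distinct_map)
  then show ?thesis by blast
qed

lemma closed_w_imp_undirected_cycle: "closed_w p \<Longrightarrow> \<exists>vs es. undirected_cycle G vs es"
  using closed_w_imp_cycle cycle_imp_undirected_cycle by blast

text \<open>A common vertex \<open>y\<close> other than the ends cuts off two shorter walks with the
  same last arrows. Walks meeting only in their ends form the cycle: along \<open>p\<close> and back
  along \<open>p'\<close>.\<close>

lemma confluent_walks_imp_undirected_cycle:
  assumes "awalk x p v" "awalk x p' v" "p \<noteq> []" "p' \<noteq> []" "last p \<noteq> last p'"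
  shows "\<exists>vs es. undirected_cycle G vs es"
  using assms
proof (induction "length p + length p'" arbitrary: x p p' rule: less_induct)
  case less
  note p = less.prems
  show ?case
  proof (cases "\<exists>q. closed_w q")
    case True
    then show ?thesis using closed_w_imp_undirected_cycle by blast
  next
    case no_closed: False
    \<comment> \<open>A vertex repeated on one walk would already give a directed closed
      walk.\<close>
    have dist: "distinct (awalk_verts x p)" "distinct (awalk_verts x p')"
      using awalk_not_distinct_decomp[OF p(1)] awalk_not_distinct_decomp[OF p(2)] no_closed
      by (auto simp: closed_w_def)
    show ?thesis
    proof (cases "\<exists>y. y \<in> set (awalk_verts x p) \<and> y \<in> set (awalk_verts x p') \<and> y \<noteq> x \<and> y \<noteq> v")
      case True
      then obtain y where y: "y \<in> set (awalk_verts x p)" "y \<in> set (awalk_verts x p')" "y \<noteq> x" "y \<noteq> v"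
        by blast
      obtain q r where qr: "p = q @ r" "awalk x q y" "awalk y r v"
        using awalk_decomp[OF p(1) y(1)] by blast
      obtain q' r' where qr': "p' = q' @ r'" "awalk x q' y" "awalk y r' v"
        using awalk_decomp[OF p(2) y(2)] by blast
      have "r \<noteq> []" "r' \<noteq> []" "q \<noteq> []" "q' \<noteq> []"
        using qr qr' y by (auto simp: awalk_def)
      then show ?thesis
        using less.hyps[of r r' y] qr qr' p by auto
    next
      case False
      \<comment> \<open>Along \<open>p\<close> the vertices are the tails, starting with
        \<open>x\<close>; on the way back they are the heads of \<open>p'\<close>, starting with
        \<open>v\<close>. Each end is thus listed once.\<close>
      let ?vs = "map (tail G) p @ map (head G) (rev p')" and ?es = "p @ rev p'"
      have vs: "awalk_verts x p = map (tail G) p @ [v]" "awalk_verts x p' = map (tail G) p' @ [v]"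
        using p awalk_chain(3)[OF p(1)] awalk_chain(3)[OF p(2)]
        by (simp_all add: awalk_verts_conv last_conv_nth)
      have vs': "awalk_verts x p = x # map (head G) p" "awalk_verts x p' = x # map (head G) p'"
        using p by (auto simp: awalk_verts_conv')
      have d: "distinct (map (tail G) p)" "distinct (map (head G) p)" "distinct (map (head G) p')"
        "v \<notin> tail G ` set p" "x \<notin> head G ` set p" "x \<notin> head G ` set p'"
        using dist[unfolded vs] dist[unfolded vs'] by auto
      have disj: "tail G ` set p \<inter> head G ` set p' = {}"
      proof -
        have "y = x \<or> y = v" if "y \<in> tail G ` set p" "y \<in> head G ` set p'" for y
          using that False unfolding vs(1) vs'(2) by auto
        then show ?thesis using d by blast
      qed
      \<comment> \<open>An arrow common to both walks has its ends among \<open>x\<close> and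
        \<open>v\<close>, so its head is \<open>v\<close> and it is the last arrow of each walk.
        Different last arrows exclude this.\<close>
      have e: "e = last p \<and> e = last p'" if "e \<in> set p" "e \<in> set p'" for e
      proof -
        have "tail G e = x \<or> tail G e = v"
          using False that unfolding vs by auto
        moreover have "head G e = x \<or> head G e = v"
          using False that unfolding vs' by auto
        moreover have "tail G e \<noteq> v" "head G e \<noteq> x"
          using d(4,5) that by (metis imageI)+
        ultimately have "head G e = v" using that d(4,5) by metis
        moreover have "head G (last p) = v" "head G (last p') = v"
          using awalk_chain(3)[OF p(1)] awalk_chain(3)[OF p(2)] p by (simp_all add: last_conv_nth)
        ultimately show ?thesis
          using d(2,3) that p by (metis distinct_map inj_onD last_in_set)
      qed
      have "distinct ?es"
        using d e p(5) by (auto simp: distinct_map)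
      moreover have "distinct ?vs"
        using d disj by (auto simp: distinct_map)
      moreover have "{tail G (?es ! i), head G (?es ! i)} = {?vs ! i, ?vs ! (Suc i mod length ?es)}"
        if i: "i < length ?es" for i
      proof (cases "i < length p")
        case True
        have "?vs ! Suc i = head G (p ! i)"
        proof (cases "Suc i < length p")
          case True
          then show ?thesis using awalk_chain(1)[OF p(1) True] by (simp add: nth_append)
        next
          case False
          then have "Suc i = length p" using \<open>i < length p\<close> by simp
          moreover have "i = length p - 1" using calculation by simp
          ultimately show ?thesis
            using awalk_chain(3)[OF p(1)] awalk_chain(3)[OF p(2)] p by (simp add: nth_append rev_nth)
        qed
        moreover have "Suc i < length ?es" using True p by (cases p') auto
        ultimately show ?thesis using True by (simp add: nth_append)
      next
        case False
        \<comment> \<open>The returning half reads \<open>p'\<close> backwards: position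
          \<open>i\<close> of the cycle is position \<open>j\<close> of \<open>p'\<close>, and
          \<open>j = 0\<close> closes up at \<open>x\<close>.\<close>
        define j where "j = length p + length p' - Suc i"
        have j: "j < length p'" "?es ! i = p' ! j" "?vs ! i = head G (p' ! j)"
          using False i by (auto simp: j_def nth_append rev_nth add.commute)
        have "?vs ! (Suc i mod length ?es) = tail G (p' ! j)"
        proof (cases "Suc i < length ?es")
          case True
          then have "?vs ! Suc i = head G (p' ! (j - 1))" "Suc (j - 1) = j"
            using False by (auto simp: j_def nth_append rev_nth add.commute)
          then show ?thesis
            using awalk_chain(1)[OF p(2), of "j - 1"] j True by simp
        next
          case no: False
          then have "Suc i = length ?es" using i by simp
          then have "j = 0" "Suc i mod length ?es = 0" by (simp_all add: j_def)
          then show ?thesis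
            using awalk_chain(2)[OF p(1)] awalk_chain(2)[OF p(2)] p by (simp add: nth_append)
        qed
        then show ?thesis using j by (simp add: insert_commute)
      qed
      ultimately have "undirected_cycle G ?vs ?es"
        using p by (auto simp: undirected_cycle_def awalk_def)
      then show ?thesis by blast
    qed
  qed
qed

end

text \<open>What the later arguments draw on in a rooted tree: parents are unique and, the digraph
  being finite, \<open>acyclic_ends\<close> makes the parent relation well-founded.\<close>

locale arborescence = fin_digraph T for T :: "('n, 'e) pre_digraph" +
  assumes in_arc_unique: "a \<in> arcs T \<Longrightarrow> a' \<in> arcs T \<Longrightarrow> head T a = head T a' \<Longrightarrow> a = a'"
    and acyclic_ends: "acyclic (arcs_ends T)"

text \<open>Ascending from any vertex ends in a source, hence in the unique one, \<open>r\<close>.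
  Two arrows with the same head then extend walks from \<open>r\<close> to walks with different last
  arrows, which \<open>confluent_walks_imp_undirected_cycle\<close> turns into a forbidden
  cycle.\<close>

lemma rooted_tree_imp_arborescence:
  assumes "rooted_tree T"
  shows "arborescence T"
proof -
  have fin: "fin_digraph T" and no_cycle: "\<And>vs es. \<not> undirected_cycle T vs es"
    and root: "\<exists>!r. r \<in> verts T \<and> in_arcs T r = {}"
    using assms by (auto simp: rooted_tree_def quiver_tree_def)
  interpret fin_digraph T by fact
  obtain r where r: "\<And>x. x \<in> verts T \<Longrightarrow> in_arcs T x = {} \<Longrightarrow> x = r"
    using root by blast
  have acyc: "acyclic (arcs_ends T)"
  proof (rule acyclicI, intro allI notI)
    fix x assume "(x, x) \<in> (arcs_ends T)\<^sup>+"
    then obtain p where "awalk x p x" "p \<noteq> []"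
      using reachable1_awalk by blast
    then show False
      using closed_w_imp_undirected_cycle no_cycle by (auto simp: closed_w_def)
  qed
  then have wf: "wf (arcs_ends T)"
    by (intro finite_acyclic_wf) (simp add: arcs_ends_def)
  have from_root: "\<exists>p. awalk r p x" if "x \<in> verts T" for x
    using wf that
  proof (induction x)
    case (less x)
    show ?case
    proof (cases "in_arcs T x = {}")
      case True
      then show ?thesis using r[OF less.prems] less.prems by (auto intro: exI[of _ "[]"] simp: awalk_Nil_iff)
    next
      case False
      then obtain a where a: "a \<in> arcs T" "head T a = x" by (auto simp: in_arcs_def)
      then obtain p where "awalk r p (tail T a)"
        using less.IH[of "tail T a"] by (force simp: arcs_ends_def arc_to_ends_def)
      then have "awalk r (p @ [a]) x"
        using a by (auto simp: awalk_simps)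
      then show ?thesis by blast
    qed
  qed
  have "a = a'" if a: "a \<in> arcs T" "a' \<in> arcs T" "head T a = head T a'" for a a'
  proof (rule ccontr)
    assume "a \<noteq> a'"
    obtain p p' where "awalk r p (tail T a)" "awalk r p' (tail T a')"
      using from_root a by fastforce
    then have "awalk r (p @ [a]) (head T a)" "awalk r (p' @ [a']) (head T a)"
      using a by (auto simp: awalk_simps)
    then show False
      using confluent_walks_imp_undirected_cycle[of r "p @ [a]" "head T a" "p' @ [a']"] \<open>a \<noteq> a'\<close> no_cycle
      by auto
  qed
  with acyc fin show ?thesis
    by (auto intro: arborescence.intro simp: arborescence_axioms_def)
qed

section \<open>Homomorphisms as matrices\<close>

definition matrix_map ::
  "('n, 'e) pre_digraph \<Rightarrow> ('n \<Rightarrow> 'm \<Rightarrow> 'k::field) \<Rightarrow> ('n \<Rightarrow> 'k) \<Rightarrow> 'm \<Rightarrow> 'k" where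
  "matrix_map T h v = (if v \<in> tree_space T then (\<lambda>m. \<Sum>n\<in>verts T. v n * h n m) else 0)"

text \<open>In an arborescence the right-hand sum has at most one term. Written as a sum it also
  covers a root \<open>m\<close> and an incoming arrow of another colour, and it makes sense for all
  finite digraphs.\<close>

definition hom_matrix ::
  "('n, 'e) pre_digraph \<Rightarrow> ('n, 'e, 'q, 'a) quiver_map \<Rightarrow> ('m, 'f) pre_digraph \<Rightarrow> ('m, 'f, 'q, 'a) quiver_map
    \<Rightarrow> ('n \<Rightarrow> 'm \<Rightarrow> 'k::field) \<Rightarrow> bool" where
  "hom_matrix T1 F1 T2 F2 h \<longleftrightarrow>
     (\<forall>n m. h n m \<noteq> 0 \<longrightarrow> n \<in> verts T1 \<and> m \<in> verts T2 \<and> on_vert F1 n = on_vert F2 m) \<and>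
     (\<forall>n \<gamma> m. (\<Sum>a | a \<in> arcs T1 \<and> tail T1 a = n \<and> on_arr F1 a = \<gamma>. h (head T1 a) m) =
              (\<Sum>b | b \<in> arcs T2 \<and> head T2 b = m \<and> on_arr F2 b = \<gamma>. h n (tail T2 b)))"

lemma basis_elem_in_tree_space: "n \<in> verts T \<Longrightarrow> basis_elem n \<in> tree_space T"
  by (auto simp: tree_space_def basis_elem_def split: if_splits)

lemma matrix_map_basis_elem:
  assumes "finite (verts T)" "n \<in> verts T"
  shows "matrix_map T h (basis_elem n) m = h n m"
proof -
  have "(\<Sum>x\<in>verts T. basis_elem n x * h x m) = (\<Sum>x\<in>verts T. if x = n then h n m else 0)"
    by (intro sum.cong) (auto simp: basis_elem_def)
  then show ?thesis
    using assms by (simp add: matrix_map_def basis_elem_in_tree_space)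
qed

lemma matrix_map_add: "matrix_map T (h + h') = matrix_map T h + matrix_map T h'"
  by (auto simp: matrix_map_def fun_eq_iff algebra_simps sum.distrib)

lemma matrix_map_scale: "matrix_map T (\<lambda>n m. c * h n m) = map_scale c (matrix_map T h)"
  by (auto simp: matrix_map_def map_scale_def vscale_def fun_eq_iff algebra_simps sum_distrib_left)

text \<open>One closure property for all uses: subtracting a multiple shrinks a support,
  \<open>c = -1\<close> gives sums, and \<open>h' = h\<close> with \<open>c = 1 - k\<close> gives
  the multiple by \<open>k\<close>.\<close>

lemma hom_matrix_diff_scale:
  assumes "hom_matrix T1 F1 T2 F2 h" "hom_matrix T1 F1 T2 F2 h'"
  shows "hom_matrix T1 F1 T2 F2 (\<lambda>n m. h n m - c * h' n m)"
proof -
  have "h n m \<noteq> 0 \<or> h' n m \<noteq> 0" if "h n m - c * h' n m \<noteq> 0" for n m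
    using that by auto
  then show ?thesis
    using assms unfolding hom_matrix_def
    by (simp add: sum_subtractf flip: sum_distrib_left) blast
qed

section \<open>The action of an arrow in coordinates\<close>

context fin_digraph begin

lemma rep_action_apply:
  "rep_action (tree_module G F) \<gamma> v m =
     (\<Sum>b | b \<in> arcs G \<and> head G b = m \<and> on_arr F b = \<gamma>. v (tail G b))"
  for v :: "_ \<Rightarrow> 'k::field"
proof -
  let ?S = "{a \<in> arcs G. on_arr F a = \<gamma>}"
  have "rep_action (tree_module G F) \<gamma> v m =
      (\<Sum>n\<in>verts G. \<Sum>a\<in>{a \<in> ?S. tail G a = n}. v (tail G a) * basis_elem (head G a) m)"
    by (simp add: tree_module_def sum_fun_apply vscale_def sum_distrib_left)
      (intro sum.cong, auto)
  also have "\<dots> = (\<Sum>a\<in>?S. v (tail G a) * basis_elem (head G a) m)"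
    by (rule sum.group) auto
  also have "\<dots> = (\<Sum>a\<in>?S. if head G a = m then v (tail G a) else 0)"
    by (intro sum.cong) (auto simp: basis_elem_def)
  also have "\<dots> = (\<Sum>a\<in>{a \<in> ?S. head G a = m}. v (tail G a))"
    by (rule sum.inter_filter[symmetric]) simp
  also have "{a \<in> ?S. head G a = m} = {b \<in> arcs G. head G b = m \<and> on_arr F b = \<gamma>}"
    by auto
  finally show ?thesis .
qed

lemma rep_action_in_tree_space:
  "rep_action (tree_module G F) \<gamma> v \<in> tree_space G" for v :: "_ \<Rightarrow> 'k::field"
  using rep_action_nonzero[of G F \<gamma> v] by (fastforce simp: tree_space_def)

text \<open>A sum over all arrows of colour \<open>\<gamma>\<close> is grouped by heads first and by
  tails afterwards. The coefficient of \<open>v n\<close> then is the left-hand side of the equation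
  in \<open>hom_matrix\<close>; acting after the map produces the right-hand side.\<close>

lemma matrix_map_rep_action:
  "matrix_map G h (rep_action (tree_module G F) \<gamma> v) m =
     (\<Sum>n\<in>verts G. v n * (\<Sum>a | a \<in> arcs G \<and> tail G a = n \<and> on_arr F a = \<gamma>. h (head G a) m))"
  for v :: "_ \<Rightarrow> 'k::field"
proof -
  let ?S = "{a \<in> arcs G. on_arr F a = \<gamma>}"
  have "matrix_map G h (rep_action (tree_module G F) \<gamma> v) m =
      (\<Sum>n\<in>verts G. \<Sum>a\<in>{a \<in> ?S. head G a = n}. v (tail G a) * h (head G a) m)"
    by (simp add: matrix_map_def rep_action_in_tree_space rep_action_apply sum_distrib_right)
      (intro sum.cong, auto)
  also have "\<dots> = (\<Sum>a\<in>?S. v (tail G a) * h (head G a) m)"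
    by (rule sum.group) auto
  also have "\<dots> = (\<Sum>n\<in>verts G. \<Sum>a\<in>{a \<in> ?S. tail G a = n}. v (tail G a) * h (head G a) m)"
    by (rule sum.group[symmetric]) auto
  also have "\<dots> = (\<Sum>n\<in>verts G. v n * (\<Sum>a | a \<in> arcs G \<and> tail G a = n \<and> on_arr F a = \<gamma>. h (head G a) m))"
    by (simp add: sum_distrib_left) (intro sum.cong, auto)
  finally show ?thesis .
qed

end

lemma rep_hom_tree_modules:
  fixes T1 :: "('n, 'e) pre_digraph" and T2 :: "('m, 'f) pre_digraph"
  assumes "fin_digraph T1" "fin_digraph T2" "quiver_morphism T1 Q F1" "quiver_morphism T2 Q F2"
  shows "rep_hom Q (tree_module T1 F1 :: ('q, 'a, 'n \<Rightarrow> 'k::field) rep) (tree_module T2 F2) =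
    matrix_map T1 ` {h. hom_matrix T1 F1 T2 F2 h}"
proof -
  interpret A: fin_digraph T1 by fact
  interpret B: fin_digraph T2 by fact
  interpret V1: vector_space "vscale :: 'k \<Rightarrow> ('n \<Rightarrow> 'k) \<Rightarrow> 'n \<Rightarrow> 'k"
    by (rule vector_space_vscale)
  let ?M1 = "tree_module T1 F1 :: ('q, 'a, 'n \<Rightarrow> 'k) rep"
  let ?M2 = "tree_module T2 F2 :: ('q, 'a, 'm \<Rightarrow> 'k) rep"
  have total: "rep_total Q ?M1 = tree_space T1" "rep_total Q ?M2 = tree_space T2"
    using assms by (simp_all add: rep_total_tree_module)
  have act: "rep_action ?M2 \<gamma> (matrix_map T1 h v) m =
      (\<Sum>n\<in>verts T1. v n * (\<Sum>b | b \<in> arcs T2 \<and> head T2 b = m \<and> on_arr F2 b = \<gamma>. h n (tail T2 b)))"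
    if "v \<in> tree_space T1" for \<gamma> h v m
    using that by (simp add: B.rep_action_apply matrix_map_def sum_distrib_left) (rule sum.swap)
  show ?thesis
  proof (intro Set.equalityI subsetI)
    fix f assume "f \<in> matrix_map T1 ` {h :: 'n \<Rightarrow> 'm \<Rightarrow> 'k. hom_matrix T1 F1 T2 F2 h}"
    then obtain h :: "'n \<Rightarrow> 'm \<Rightarrow> 'k" where f: "f = matrix_map T1 h" and h: "hom_matrix T1 F1 T2 F2 h"
      by blast
    have nz: "\<exists>n. v n \<noteq> 0 \<and> on_vert F1 n = on_vert F2 m \<and> m \<in> verts T2"
      if "v \<in> tree_space T1" "matrix_map T1 h v m \<noteq> 0" for v m
    proof -
      have "(\<Sum>n\<in>verts T1. v n * h n m) \<noteq> 0"
        using that by (simp add: matrix_map_def)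
      then obtain n where "v n * h n m \<noteq> 0"
        by (rule sum.not_neutral_contains_not_neutral)
      then show ?thesis using h by (auto simp: hom_matrix_def)
    qed
    have "f v \<in> tree_space T2" if "v \<in> tree_space T1" for v
      using nz[OF that] by (auto simp: f tree_space_def)
    moreover have "f v \<in> rep_space ?M2 x" if "v \<in> rep_space ?M1 x" for v x
      using that nz[of v] by (fastforce simp: f tree_module_def tree_space_def)
    moreover have "f (u + v) = f u + f v" "f (vscale c v) = vscale c (f v)"
      if "u \<in> tree_space T1" "v \<in> tree_space T1" for u v c
      using that V1.subspace_add[OF subspace_tree_space, of u T1 v]
        V1.subspace_scale[OF subspace_tree_space, of v T1 c]
      by (auto simp: f matrix_map_def fun_eq_iff vscale_def algebra_simps sum.distrib sum_distrib_left)
    moreover have "f (rep_action ?M1 \<gamma> v) = rep_action ?M2 \<gamma> (f v)" if "v \<in> tree_space T1" for \<gamma> v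
      using h that by (auto simp: f A.matrix_map_rep_action act hom_matrix_def)
    moreover have "v \<in> tree_space T1" if "v \<in> rep_space ?M1 x" for v x
      using that by (simp add: tree_module_def)
    ultimately show "f \<in> rep_hom Q ?M1 ?M2"
      unfolding rep_hom_def linear_between_def total by (auto simp: f matrix_map_def)
  next
    fix f assume "f \<in> rep_hom Q ?M1 ?M2"
    then have lin: "linear_between (tree_space T1) (tree_space T2) f"
      and zero: "\<And>v. v \<notin> tree_space T1 \<Longrightarrow> f v = 0"
      and sp: "\<And>x v. x \<in> verts Q \<Longrightarrow> v \<in> rep_space ?M1 x \<Longrightarrow> f v \<in> rep_space ?M2 x"
      and com: "\<And>\<gamma> v. \<gamma> \<in> arcs Q \<Longrightarrow> v \<in> rep_space ?M1 (tail Q \<gamma>) \<Longrightarrow>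
        f (rep_action ?M1 \<gamma> v) = rep_action ?M2 \<gamma> (f v)"
      by (auto simp: rep_hom_def total)
    define h where "h n m = (if n \<in> verts T1 then f (basis_elem n) m else 0)" for n m
    have f_sum: "f (\<Sum>n\<in>A. vscale (c n) (basis_elem n)) = (\<Sum>n\<in>A. vscale (c n) (f (basis_elem n)))"
      if "A \<subseteq> verts T1" for A c
      using finite_subset[OF that A.finite_verts] that
    proof (induction A rule: finite_induct)
      case empty
      \<comment> \<open>\<open>f\<close> is linear on the tree space only, so \<open>f 0 = 0\<close>
        comes from scaling by 0, and each partial sum has to be placed in that space.\<close>
      have "f (vscale 0 0) = vscale 0 (f 0)"
        using lin V1.subspace_0[OF subspace_tree_space[of T1]] by (simp only: linear_between_def)
      then show ?case by (simp add: vscale_def zero_fun_def)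
    next
      case (insert n A)
      have "(\<Sum>n\<in>A. vscale (c n) (basis_elem n)) \<in> tree_space T1"
        using insert.prems
        by (intro V1.subspace_sum V1.subspace_scale subspace_tree_space basis_elem_in_tree_space) auto
      moreover have b: "basis_elem n \<in> tree_space T1"
        using insert.prems by (simp add: basis_elem_in_tree_space)
      moreover have "vscale (c n) (basis_elem n) \<in> tree_space T1"
        using b by (rule V1.subspace_scale[OF subspace_tree_space])
      ultimately have add: "f (vscale (c n) (basis_elem n) + (\<Sum>n\<in>A. vscale (c n) (basis_elem n))) =
          f (vscale (c n) (basis_elem n)) + f (\<Sum>n\<in>A. vscale (c n) (basis_elem n))"
        using lin unfolding linear_between_def by blast
      have scale: "f (vscale (c n) (basis_elem n)) = vscale (c n) (f (basis_elem n))"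
        using b lin unfolding linear_between_def by blast
      have IH: "f (\<Sum>n\<in>A. vscale (c n) (basis_elem n)) = (\<Sum>n\<in>A. vscale (c n) (f (basis_elem n)))"
        using insert by blast
      show ?case
        unfolding sum.insert[OF insert.hyps] add scale IH by (rule refl)
    qed
    have f: "f = matrix_map T1 h"
    proof (intro ext)
      fix v m
      show "f v m = matrix_map T1 h v m"
      proof (cases "v \<in> tree_space T1")
        case True
        have "v = (\<Sum>n\<in>verts T1. vscale (v n) (basis_elem n))"
        proof
          fix x
          have "(\<Sum>n\<in>verts T1. v n * basis_elem n x) = (\<Sum>n\<in>verts T1. if n = x then v x else 0)"
            by (intro sum.cong) (auto simp: basis_elem_def)
          then show "v x = (\<Sum>n\<in>verts T1. vscale (v n) (basis_elem n)) x"
            using True by (auto simp: sum_fun_apply vscale_def tree_space_def)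
        qed
        then have "f v = (\<Sum>n\<in>verts T1. vscale (v n) (f (basis_elem n)))"
          using f_sum[of "verts T1" v] by simp
        then show ?thesis
          using True by (simp add: matrix_map_def h_def sum_fun_apply vscale_def)
      next
        case False then show ?thesis by (simp add: zero matrix_map_def)
      qed
    qed
    have basis: "basis_elem n \<in> rep_space ?M1 (on_vert F1 n)" if "n \<in> verts T1" for n
      using basis_elem_in_tree_space[OF that]
      by (auto simp: tree_module_def basis_elem_def split: if_splits)
    have supp: "n \<in> verts T1 \<and> m \<in> verts T2 \<and> on_vert F1 n = on_vert F2 m" if "h n m \<noteq> 0" for n m
    proof -
      have n: "n \<in> verts T1" using that by (simp add: h_def split: if_splits)
      then have "f (basis_elem n) \<in> rep_space ?M2 (on_vert F1 n)"
        using assms(3) by (intro sp basis) (auto simp: quiver_morphism_def)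
      then show ?thesis
        using that n by (auto simp: h_def tree_module_def tree_space_def)
    qed
    \<comment> \<open>If \<open>\<gamma>\<close> starts over \<open>n\<close>, this is compatibility
      with \<open>\<gamma>\<close> evaluated at \<open>basis_elem n\<close>. Otherwise both sums
      vanish, the left one because no arrow qualifies, the right one by the support of
      \<open>h\<close>.\<close>
    have eq: "(\<Sum>a | a \<in> arcs T1 \<and> tail T1 a = n \<and> on_arr F1 a = \<gamma>. h (head T1 a) m) =
        (\<Sum>b | b \<in> arcs T2 \<and> head T2 b = m \<and> on_arr F2 b = \<gamma>. h n (tail T2 b))" for n \<gamma> m
    proof (cases "\<gamma> \<in> arcs Q \<and> n \<in> verts T1 \<and> on_vert F1 n = tail Q \<gamma>")
      case True
      then have n: "(basis_elem n :: 'n \<Rightarrow> 'k) \<in> tree_space T1" and "f (rep_action ?M1 \<gamma> (basis_elem n)) m =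
          rep_action ?M2 \<gamma> (f (basis_elem n)) m"
        using com[of \<gamma> "basis_elem n"] basis[of n] basis_elem_in_tree_space[of n] by auto
      moreover have "(\<Sum>x\<in>verts T1. basis_elem n x * g x) = g n" for g :: "'n \<Rightarrow> 'k"
      proof -
        have "(\<Sum>x\<in>verts T1. basis_elem n x * g x) = (\<Sum>x\<in>verts T1. if x = n then g n else 0)"
          by (intro sum.cong) (auto simp: basis_elem_def)
        then show ?thesis using True by simp
      qed
      ultimately show ?thesis
        by (simp add: f A.matrix_map_rep_action act)
    next
      case False
      have "a \<in> arcs T1 \<Longrightarrow> \<not> (tail T1 a = n \<and> on_arr F1 a = \<gamma>)" for a
        using False assms(3) A.tail_in_verts unfolding quiver_morphism_def by auto
      moreover have "h n (tail T2 b) = 0" if "b \<in> arcs T2" "on_arr F2 b = \<gamma>" for b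
        using False assms(4) that supp[of n "tail T2 b"] unfolding quiver_morphism_def by force
      ultimately show ?thesis by (auto intro!: sum.neutral trans[OF sum.neutral sum.neutral[symmetric]])
    qed
    show "f \<in> matrix_map T1 ` {h. hom_matrix T1 F1 T2 F2 h}"
      using f supp eq by (auto simp: hom_matrix_def intro!: image_eqI[of _ _ h])
  qed
qed

section \<open>Triangles in simple networks\<close>

definition adjacent :: "('v, 'e) network \<Rightarrow> 'v \<Rightarrow> 'v \<Rightarrow> bool" where
  "adjacent N u v \<longleftrightarrow> (\<exists>l. joins N l u v)"

text \<open>Since \<open>joins\<close> also reads arrows backwards, the second clause excludes
  opposite arrows and an arrow alongside an edge as well. In such a network triangles and turning
  back can be expressed by adjacency alone.\<close>

definition simple_network :: "('v, 'e) network \<Rightarrow> bool" where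
  "simple_network N \<longleftrightarrow>
     (\<forall>u. \<not> adjacent N u u) \<and> (\<forall>l l' u v. joins N l u v \<and> joins N l' u v \<longrightarrow> l = l')"

lemma simple_network_link: "simple_network N \<Longrightarrow> joins N l u v \<Longrightarrow> joins N l' u v \<Longrightarrow> l = l'"
  unfolding simple_network_def by blast

lemma simple_network_loop: "simple_network N \<Longrightarrow> \<not> adjacent N u u"
  unfolding simple_network_def by blast

lemma joins_inv: "joins N l u v \<Longrightarrow> joins N (link_inv l) v u"
  by (cases l) auto

lemma adjacent_sym: "adjacent N u v \<Longrightarrow> adjacent N v u"
  unfolding adjacent_def by (metis joins_inv)

lemma joins_target: "joins N l u v \<Longrightarrow> joins N l u w \<Longrightarrow> v = w"
  by (cases l) (auto simp: doubleton_eq_iff)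

lemma joins_in_verts:
  assumes "is_network N" "joins N l u v"
  shows "u \<in> verts (quiver N) \<and> v \<in> verts (quiver N)"
  using assms by (cases l) (auto simp: is_network_def wf_digraph_def)

lemma joins_subnetwork: "subnetwork M N \<Longrightarrow> joins M l u v \<Longrightarrow> joins N l u v"
  by (cases l) (auto simp: subnetwork_def subgraph_def compatible_def)

lemma joins_not_inverse_iff:
  assumes "simple_network N" "joins N l u v" "joins N l' v w"
  shows "l' \<noteq> link_inv l \<longleftrightarrow> u \<noteq> w"
  using assms simple_network_link[OF assms(1)] joins_inv[OF assms(2)] joins_target[of N l' v] by metis

lemma simple_subnetwork: "subnetwork M N \<Longrightarrow> simple_network N \<Longrightarrow> simple_network M"
  using joins_subnetwork[of M N] unfolding simple_network_def adjacent_def by metis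

lemma traversals_length_two:
  assumes "is_network N" "simple_network N" "joins N l u v" "joins N l' v w"
  shows "(u, [l, l']) \<in> traversals N \<longleftrightarrow> u \<noteq> w"
proof -
  have "w \<in> verts (quiver N)"
    using joins_in_verts[OF assms(1,4)] by simp
  then have "link_walk N u [l, l'] w"
    using assms(3,4) by auto
  then show ?thesis
    using joins_not_inverse_iff[OF assms(2-4)]
    by (auto simp: traversals_def traversal_def simp del: link_walk.simps)
qed

text \<open>Sending an arrow to the set of its ends is injective and misses the edges, because two
  vertices are joined by at most one link.\<close>

lemma card_induced_links:
  assumes N: "is_network N" "simple_network N" and "finite X"
  shows "card (arcs (quiver N \<restriction> X)) + card {e \<in> edges N. e \<subseteq> X} =
    card {{x, y} | x y. x \<in> X \<and> y \<in> X \<and> adjacent N x y}"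
proof -
  let ?A = "arcs (quiver N \<restriction> X)" and ?E = "{e \<in> edges N. e \<subseteq> X}"
  let ?g = "\<lambda>a. {tail (quiver N) a, head (quiver N) a}"
  define P where "P = {{x, y} | x y. x \<in> X \<and> y \<in> X \<and> adjacent N x y}"
  note uniq = simple_network_link[OF N(2)]
  have arrow: "joins N (Arrow a) (tail (quiver N) a) (head (quiver N) a)" if "a \<in> ?A" for a
    using that by simp
  have inj: "inj_on ?g ?A"
  proof (rule inj_onI)
    fix a a' assume a: "a \<in> ?A" "a' \<in> ?A" "?g a = ?g a'"
    let ?s = "tail (quiver N) a" and ?t = "head (quiver N) a"
    have "joins N (Arrow a') ?s ?t \<or> joins N (Inverse a') ?s ?t"
      using a by (auto simp: doubleton_eq_iff)
    then show "a = a'"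
      using uniq[OF arrow[OF a(1)]] by (metis link.distinct(1) link.inject(1))
  qed
  have "?g a \<notin> ?E" if "a \<in> ?A" for a
  proof
    assume "?g a \<in> ?E"
    then have "joins N (Edge (?g a)) (tail (quiver N) a) (head (quiver N) a)" by simp
    from uniq[OF arrow[OF that] this] show False by simp
  qed
  then have disjoint: "?g ` ?A \<inter> ?E = {}" by blast
  have P: "?g ` ?A \<union> ?E = P"
  proof -
    have "e \<in> P" if "e \<in> ?g ` ?A" for e
      using that arrow unfolding P_def adjacent_def by fastforce
    moreover have "e \<in> P" if "e \<in> ?E" for e
    proof -
      have "card e = 2" using that N(1) by (auto simp: is_network_def)
      then obtain x y where "e = {x, y}" by (auto simp: card_2_iff)
      moreover then have "joins N (Edge e) x y" using that by simp
      ultimately show ?thesis using that unfolding P_def adjacent_def by blast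
    qed
    moreover have "e \<in> ?g ` ?A \<union> ?E" if e: "e \<in> P" for e
    proof -
      obtain x y l where xy: "e = {x, y}" "x \<in> X" "y \<in> X" "joins N l x y"
        using e by (auto simp: P_def adjacent_def)
      show ?thesis
      proof (cases l)
        case (Arrow a) then show ?thesis using xy by auto
      next
        case (Inverse a) then have "a \<in> ?A" "e = ?g a" using xy by auto
        then show ?thesis by blast
      next
        case (Edge e') then show ?thesis using xy by auto
      qed
    qed
    ultimately show ?thesis by blast
  qed
  have "P \<subseteq> Pow X" by (auto simp: P_def)
  then have "finite P" using \<open>finite X\<close> by (meson finite_Pow_iff finite_subset)
  then have fin: "finite (?g ` ?A)" "finite ?E" by (simp_all only: P[symmetric] finite_Un)
  have "card (?g ` ?A) + card ?E = card P"
    unfolding P[symmetric] by (rule card_Un_disjoint[symmetric]) (fact fin disjoint)+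
  then have "card ?A + card ?E = card P"
    by (simp only: card_image[OF inj])
  then show ?thesis by (simp add: P_def)
qed

text \<open>Each of the three pairs contributes at most one link. With two pairs linked already, the
  total is three exactly when the third pair is linked.\<close>

lemma triangle_iff_adjacent:
  assumes N: "is_network N" "simple_network N"
    and uvw: "adjacent N u v" "adjacent N v w" "u \<noteq> w"
  shows "triangle N {u, v, w} \<longleftrightarrow> adjacent N u w"
proof -
  let ?X = "{u, v, w}"
  let ?P = "{{x, y} | x y. x \<in> ?X \<and> y \<in> ?X \<and> adjacent N x y}"
  let ?R = "{{u, v}, {v, w}} \<union> (if adjacent N u w then {{u, w}} else {})"
  note loop = simple_network_loop[OF N(2)]
  have dist: "u \<noteq> v" "v \<noteq> w" using uvw loop by blast+
  have PR: "e \<in> ?R" if xy: "x \<in> ?X" "y \<in> ?X" "adjacent N x y" "e = {x, y}" for x y e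
  proof -
    have "x \<noteq> y" using that loop by blast
    then have "e = {u, v} \<or> e = {v, w} \<or> e = {u, w} \<and> adjacent N u w"
      using xy(1,2,3) adjacent_sym[of N w u] unfolding xy(4) by blast
    then show ?thesis by auto
  qed
  have "{u, v} \<in> ?P" "{v, w} \<in> ?P" "adjacent N u w \<Longrightarrow> {u, w} \<in> ?P"
    using uvw by blast+
  then have RP: "?R \<subseteq> ?P"
    by (simp only: Un_subset_iff insert_subset empty_subsetI split: if_split) blast
  have "?P \<subseteq> ?R"
  proof
    fix e assume "e \<in> ?P"
    then obtain x y where "x \<in> ?X" "y \<in> ?X" "adjacent N x y" "e = {x, y}" by blast
    then show "e \<in> ?R" by (rule PR)
  qed
  from this RP have "?P = ?R" by (rule equalityI)
  then have "card ?P = 3 \<longleftrightarrow> adjacent N u w"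
    using dist uvw(3) by (simp add: doubleton_eq_iff card_insert_if)
  moreover have "?X \<subseteq> verts (quiver N)"
    using uvw joins_in_verts[OF N(1)] unfolding adjacent_def by blast
  moreover have "card ?X = 3" using dist uvw by simp
  ultimately show ?thesis
    unfolding triangle_def using card_induced_links[OF N, of ?X] by simp
qed

section \<open>Links of the pullback network and of the 2-covering network\<close>

locale tree_pair = A: arborescence T1 + B: arborescence T2
  for T1 :: "('n, 'e) pre_digraph" and T2 :: "('m, 'f) pre_digraph" +
  fixes Q :: "('q, 'a) pre_digraph"
    and F1 :: "('n, 'e, 'q, 'a) quiver_map" and F2 :: "('m, 'f, 'q, 'a) quiver_map"
  assumes mor1: "quiver_morphism T1 Q F1" and mor2: "quiver_morphism T2 Q F2"
begin

abbreviation N1 :: "('n \<times> 'm, 'e \<times> 'f) network" where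
  "N1 \<equiv> pullback_network T1 F1 T2 F2"

abbreviation N2 :: "('n \<times> 'm \<times> int, 'e \<times> 'f \<times> int) network" where
  "N2 \<equiv> covering_network T1 F1 T2 F2"

lemma is_network_N1: "is_network N1"
  using is_network_pullback[OF _ _ mor1 mor2] A.wf_digraph_axioms B.wf_digraph_axioms by blast

lemma is_network_N2: "is_network N2"
  using is_network_covering[OF _ _ mor1 mor2] A.wf_digraph_axioms B.wf_digraph_axioms by blast

lemma no_cycle_T2: "(x, x) \<notin> (arcs_ends T2)\<^sup>+"
  using B.acyclic_ends by (auto simp: acyclic_def)

lemma arc_T2: "b \<in> arcs T2 \<Longrightarrow> (tail T2 b, head T2 b) \<in> arcs_ends T2"
  by (auto simp: arcs_ends_def arc_to_ends_def)

lemma no_loop_T2: "b \<in> arcs T2 \<Longrightarrow> tail T2 b \<noteq> head T2 b"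
  using arc_T2[of b] no_cycle_T2 by (metis trancl.r_into_trancl)

lemma no_two_cycle_T2:
  "b \<in> arcs T2 \<Longrightarrow> b' \<in> arcs T2 \<Longrightarrow> tail T2 b = head T2 b' \<Longrightarrow> head T2 b \<noteq> tail T2 b'"
  using arc_T2[of b] arc_T2[of b'] no_cycle_T2 by (metis trancl.r_into_trancl trancl_trans)

lemma no_three_cycle_T2:
  "b \<in> arcs T2 \<Longrightarrow> b' \<in> arcs T2 \<Longrightarrow> b'' \<in> arcs T2 \<Longrightarrow> head T2 b = tail T2 b' \<Longrightarrow>
    head T2 b' = tail T2 b'' \<Longrightarrow> head T2 b'' \<noteq> tail T2 b"
  using arc_T2[of b] arc_T2[of b'] arc_T2[of b''] no_cycle_T2
  by (metis trancl.r_into_trancl trancl_trans)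

text \<open>The condition on \<open>m\<close> at one of the two vertices implies it at the other,
  because arrows of the same colour have heads over the same vertex of \<open>Q\<close>.\<close>

lemma edge_N1_iff:
  "{(n, m), (n', m')} \<in> edges N1 \<longleftrightarrow> m = m' \<and> n \<noteq> n' \<and> m \<in> verts T2 \<and> on_vert F1 n = on_vert F2 m \<and>
     (\<exists>a\<in>arcs T1. \<exists>a'\<in>arcs T1. head T1 a = n \<and> head T1 a' = n' \<and> tail T1 a = tail T1 a' \<and>
        on_arr F1 a = on_arr F1 a')" (is "?L \<longleftrightarrow> ?R")
proof
  assume ?L
  then obtain a a' m'' where a: "{(n, m), (n', m')} = {(head T1 a, m''), (head T1 a', m'')}"
    "a \<in> arcs T1" "a' \<in> arcs T1" "head T1 a \<noteq> head T1 a'" "tail T1 a = tail T1 a'"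
    "on_arr F1 a = on_arr F1 a'" "m'' \<in> verts T2" "on_vert F1 (head T1 a) = on_vert F2 m''"
    "on_vert F1 (head T1 a') = on_vert F2 m''"
    unfolding pullback_network_def Let_def by auto
  then have "(n, m) = (head T1 a, m'') \<and> (n', m') = (head T1 a', m'') \<or>
      (n, m) = (head T1 a', m'') \<and> (n', m') = (head T1 a, m'')"
    by (simp only: doubleton_eq_iff)
  then show ?R
    using a(2-) by (elim disjE) (auto, metis+)
next
  assume R: ?R
  then obtain a a' where a: "a \<in> arcs T1" "a' \<in> arcs T1" "head T1 a = n" "head T1 a' = n'"
      "tail T1 a = tail T1 a'" "on_arr F1 a = on_arr F1 a'" by blast
  then have "on_vert F1 n' = on_vert F1 n"
    using mor1 unfolding quiver_morphism_def by metis
  then have "(n, m) \<in> verts (quiver N1)" "(n', m) \<in> verts (quiver N1)"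
    using R a by (auto simp: pullback_network_def Let_def)
  moreover have "edges N1 = {{(head T1 a, m), (head T1 a', m)} | a a' m.
      a \<in> arcs T1 \<and> a' \<in> arcs T1 \<and> head T1 a \<noteq> head T1 a' \<and> tail T1 a = tail T1 a' \<and>
      on_arr F1 a = on_arr F1 a' \<and> (head T1 a, m) \<in> verts (quiver N1) \<and> (head T1 a', m) \<in> verts (quiver N1)}"
    by (simp add: pullback_network_def Let_def)
  ultimately show ?L
    using R a by blast
qed

lemma joins_N1_Arrow:
  "joins N1 (Arrow (a, b)) x y \<longleftrightarrow> a \<in> arcs T1 \<and> b \<in> arcs T2 \<and> on_arr F1 a = on_arr F2 b \<and>
     x = (tail T1 a, tail T2 b) \<and> y = (head T1 a, head T2 b)"
  by (auto simp: pullback_network_def Let_def)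

lemma joins_N1_Inverse:
  "joins N1 (Inverse (a, b)) y x \<longleftrightarrow> a \<in> arcs T1 \<and> b \<in> arcs T2 \<and> on_arr F1 a = on_arr F2 b \<and>
     x = (tail T1 a, tail T2 b) \<and> y = (head T1 a, head T2 b)"
  by (auto simp: pullback_network_def Let_def)

text \<open>The second coordinate separates the kinds of links: an edge fixes it, an arrow follows
  an arrow of \<open>T2\<close>, an inverse goes back along one, and acyclicity of \<open>T2\<close>
  makes these exclusive. Within one kind, unique incoming arrows identify the link.\<close>

lemma simple_N1: "simple_network N1"
proof -
  have E: "snd x = snd y \<and> fst x \<noteq> fst y" if "joins N1 (Edge e) x y" for e x y
    using that edge_N1_iff[of "fst x" "snd x" "fst y" "snd y"] by auto
  have Ar: "\<exists>b\<in>arcs T2. snd x = tail T2 b \<and> snd y = head T2 b" if "joins N1 (Arrow ab) x y" for ab x y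
    using that by (cases ab) (auto simp only: joins_N1_Arrow joins_N1_Inverse prod.sel prod.inject)
  have In: "\<exists>b\<in>arcs T2. snd y = tail T2 b \<and> snd x = head T2 b" if "joins N1 (Inverse ab) x y" for ab x y
    using that by (cases ab) (auto simp only: joins_N1_Arrow joins_N1_Inverse prod.sel prod.inject)
  have loop: "\<not> joins N1 l x x" for l x
    using E Ar In no_loop_T2 by (cases l) metis+
  moreover have "l = l'" if l: "joins N1 l x y" "joins N1 l' x y" for l l' x y
  proof (cases l; cases l')
    fix ab ab' assume "l = Arrow ab" "l' = Arrow ab'"
    then show ?thesis using l A.in_arc_unique B.in_arc_unique
      by (cases ab; cases ab') (auto simp only: joins_N1_Arrow joins_N1_Inverse prod.sel prod.inject)
  next
    fix ab ab' assume "l = Inverse ab" "l' = Inverse ab'"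
    then show ?thesis using l A.in_arc_unique B.in_arc_unique
      by (cases ab; cases ab') (auto simp only: joins_N1_Arrow joins_N1_Inverse prod.sel prod.inject)
  next
    fix e e' assume "l = Edge e" "l' = Edge e'" then show ?thesis using l by auto
  qed (use l E Ar In no_loop_T2 no_two_cycle_T2 in metis)+
  ultimately show ?thesis by (auto simp: simple_network_def adjacent_def)
qed

lemma edge_N2_iff:
  "{(n, m, i), (n', m', i')} \<in> edges N2 \<longleftrightarrow>
     {(n, m), (n', m')} \<in> edges N1 \<and> i \<in> {-1, 1} \<and> i' = -i" (is "?L \<longleftrightarrow> ?R")
proof
  assume ?L
  then obtain p p' q k where k: "{(n, m, i), (n', m', i')} = {(p, q, k), (p', q, -k)}"
    "{(p, q), (p', q)} \<in> edges N1" "k \<in> {-1, 1}"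
    unfolding covering_network_def Let_def by auto
  then have "(n, m, i) = (p, q, k) \<and> (n', m', i') = (p', q, -k) \<or>
      (n, m, i) = (p', q, -k) \<and> (n', m', i') = (p, q, k)"
    by (simp only: doubleton_eq_iff)
  then show ?R using k by (elim disjE) (auto simp: insert_commute)
next
  assume R: ?R
  then have "m = m'" using edge_N1_iff by blast
  with R show ?L unfolding covering_network_def Let_def by fastforce
qed

lemma joins_N2_Arrow:
  "joins N2 (Arrow (a, b, i)) x y \<longleftrightarrow> a \<in> arcs T1 \<and> b \<in> arcs T2 \<and> on_arr F1 a = on_arr F2 b \<and>
     i \<in> {-1, 1} \<and> x = (tail T1 a, tail T2 b, i) \<and> y = (head T1 a, head T2 b, i)"
  by (auto simp: covering_network_def pullback_network_def Let_def)

lemma joins_N2_Inverse: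
  "joins N2 (Inverse (a, b, i)) y x \<longleftrightarrow> a \<in> arcs T1 \<and> b \<in> arcs T2 \<and> on_arr F1 a = on_arr F2 b \<and>
     i \<in> {-1, 1} \<and> x = (tail T1 a, tail T2 b, i) \<and> y = (head T1 a, head T2 b, i)"
  by (auto simp: covering_network_def pullback_network_def Let_def)

lemma joins_N2_proj:
  assumes "joins N2 l x y"
  shows "joins N1 (proj_link l) (proj x) (proj y)"
proof (cases l)
  case (Arrow ab)
  then show ?thesis using assms by (cases ab)
      (auto simp: proj_def joins_N1_Arrow joins_N1_Inverse joins_N2_Arrow joins_N2_Inverse
        simp del: joins.simps)
next
  case (Inverse ab)
  then show ?thesis using assms by (cases ab)
      (auto simp: proj_def joins_N1_Arrow joins_N1_Inverse joins_N2_Arrow joins_N2_Inverse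
        simp del: joins.simps)
next
  case (Edge e)
  obtain n m i n' m' i' where "x = (n, m, i)" "y = (n', m', i')" by (cases x; cases y) auto
  then show ?thesis using Edge assms edge_N2_iff[of n m i n' m' i'] by (auto simp: proj_def)
qed

lemma joins_N2_sign:
  assumes "joins N2 l x y"
  shows "snd (snd y) = (case l of Edge e \<Rightarrow> - snd (snd x) | _ \<Rightarrow> snd (snd x))"
    and "\<And>ab. l = Arrow ab \<Longrightarrow> snd (snd ab) = snd (snd x)"
    and "\<And>ab. l = Inverse ab \<Longrightarrow> snd (snd ab) = snd (snd x)"
proof -
  have "snd (snd y) = - snd (snd x)" if "l = Edge e" for e
    using that assms edge_N2_iff[of "fst x" "fst (snd x)" "snd (snd x)" "fst y" "fst (snd y)" "snd (snd y)"]
    by auto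
  moreover have "snd (snd ab) = snd (snd x) \<and> snd (snd y) = snd (snd x)" if "l = Arrow ab" for ab
    using that assms by (cases ab) (auto simp only: joins_N2_Arrow joins_N2_Inverse prod.sel prod.inject)
  moreover have "snd (snd ab) = snd (snd x) \<and> snd (snd y) = snd (snd x)" if "l = Inverse ab" for ab
    using that assms by (cases ab) (auto simp only: joins_N2_Arrow joins_N2_Inverse prod.sel prod.inject)
  ultimately show "snd (snd y) = (case l of Edge e \<Rightarrow> - snd (snd x) | _ \<Rightarrow> snd (snd x))"
    "\<And>ab. l = Arrow ab \<Longrightarrow> snd (snd ab) = snd (snd x)"
    "\<And>ab. l = Inverse ab \<Longrightarrow> snd (snd ab) = snd (snd x)"
    by (auto split: link.split)
qed

lemma adjacent_N2_proj: "adjacent N2 x y \<Longrightarrow> adjacent N1 (proj x) (proj y)"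
  unfolding adjacent_def using joins_N2_proj by blast

lemma proj_link_eq_cases:
  assumes "proj_link l = proj_link l'"
  shows "(\<exists>a a'. l = Arrow a \<and> l' = Arrow a' \<and> proj a = proj a') \<or>
    (\<exists>a a'. l = Inverse a \<and> l' = Inverse a' \<and> proj a = proj a') \<or> (\<exists>e e'. l = Edge e \<and> l' = Edge e')"
  using assms by (cases l; cases l') auto

text \<open>A link of the covering is recovered from its projection and the sign at its start, or
  from its two ends if it is an edge, so simplicity lifts from \<open>N1\<close>.\<close>

lemma simple_N2: "simple_network N2"
proof -
  have "l = l'" if l: "joins N2 l x y" "joins N2 l' x y" for l l' x y
  proof -
    have "proj_link l = proj_link l'"
      using simple_network_link[OF simple_N1] l[THEN joins_N2_proj] by blast
    from proj_link_eq_cases[OF this] show ?thesis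
      using joins_N2_sign[OF l(1)] joins_N2_sign[OF l(2)] l by (auto simp: proj_def)
  qed
  moreover have "\<not> adjacent N2 x x" for x
    using adjacent_N2_proj simple_network_loop[OF simple_N1] by blast
  ultimately show ?thesis by (auto simp: simple_network_def)
qed

text \<open>The intermediate and final vertices quantified in \<open>triangle_traversals1\<close>
  are determined by the links.\<close>

lemma triangle_traversals1_iff:
  assumes "joins N1 l u v" "joins N1 l' v w"
  shows "(u, [l, l']) \<in> triangle_traversals1 T1 F1 T2 F2 \<longleftrightarrow> u \<noteq> w \<and> adjacent N1 u w"
proof -
  have "(u, [l, l']) \<in> traversals N1 \<longleftrightarrow> u \<noteq> w"
    using assms by (rule traversals_length_two[OF is_network_N1 simple_N1])
  moreover have "triangle N1 {u, v, w} \<longleftrightarrow> adjacent N1 u w" if "u \<noteq> w"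
    using assms that by (intro triangle_iff_adjacent is_network_N1 simple_N1) (auto simp: adjacent_def)
  moreover have "joins N1 l u x \<longleftrightarrow> x = v" "joins N1 l' v x \<longleftrightarrow> x = w" for x
    using assms joins_target by metis+
  ultimately show ?thesis
    unfolding triangle_traversals1_def Let_def
    using assms by (simp del: split_paired_Ex split_paired_All) metis
qed

text \<open>The walk runs in \<open>M\<close>, but its ends are compared in \<open>N1\<close>: the
  third side of a triangle never lifts to a link between \<open>u\<close> and \<open>w\<close>,
  since the signs do not fit.\<close>

lemma triangle_free_iff:
  assumes M: "subnetwork M N2"
  shows "traversals M \<inter> triangle_traversals2 T1 F1 T2 F2 = {} \<longleftrightarrow>
    (\<forall>u v w. adjacent M u v \<and> adjacent M v w \<and> u \<noteq> w \<longrightarrow> \<not> adjacent N1 (proj u) (proj w))"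
    (is "?L \<longleftrightarrow> ?R")
proof -
  have MN: "is_network M" "simple_network M"
    using M simple_subnetwork[OF M simple_N2] by (auto simp: subnetwork_def)
  have sub: "joins N2 l x y" if "joins M l x y" for l x y
    using joins_subnetwork[OF M that] .
  show ?thesis
  proof
    assume L: ?L
    show ?R
    proof (intro allI impI notI)
      fix u v w assume uvw: "adjacent M u v \<and> adjacent M v w \<and> u \<noteq> w" and adj: "adjacent N1 (proj u) (proj w)"
      then obtain l l' where l: "joins M l u v" "joins M l' v w" by (auto simp: adjacent_def)
      have "(u, [l, l']) \<in> traversals M" "(u, [l, l']) \<in> traversals N2"
        using traversals_length_two[OF MN l] traversals_length_two[OF is_network_N2 simple_N2 l[THEN sub]] uvw by auto
      moreover have "(proj u, [proj_link l, proj_link l']) \<in> triangle_traversals1 T1 F1 T2 F2"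
        using triangle_traversals1_iff[OF l[THEN sub, THEN joins_N2_proj]] adj
          simple_network_loop[OF simple_N1] by metis
      ultimately show False using L by (auto simp: triangle_traversals2_def)
    qed
  next
    assume R: ?R
    show ?L
    proof (rule ccontr)
      assume "\<not> ?L"
      then obtain u ls where uls: "(u, ls) \<in> traversals M" "(u, ls) \<in> triangle_traversals2 T1 F1 T2 F2"
        by auto
      then have t1: "(proj u, map proj_link ls) \<in> triangle_traversals1 T1 F1 T2 F2"
        by (auto simp: triangle_traversals2_def)
      then obtain l l' where ls: "ls = [l, l']"
        by (auto simp: triangle_traversals1_def Let_def)
      then obtain v w where l: "joins M l u v" "joins M l' v w"
        using uls(1) by (auto simp: traversals_def traversal_def)
      have "adjacent N1 (proj u) (proj w)" "u \<noteq> w"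
        using triangle_traversals1_iff[OF l[THEN sub, THEN joins_N2_proj]] t1 ls by auto
      then show False using R l unfolding adjacent_def by blast
    qed
  qed
qed

end

section \<open>Homomorphisms from complete triangle-free networks\<close>

text \<open>The entry at \<open>(n, m)\<close> of the matrix of the associated map; a pair occurring
  with both signs contributes 0.\<close>

definition signed_count :: "('n \<times> 'm \<times> int, 'e) network \<Rightarrow> 'n \<Rightarrow> 'm \<Rightarrow> int" where
  "signed_count M n m = \<Sum>{j. j \<in> {-1, 1} \<and> (n, m, j) \<in> verts (quiver M)}"

lemma signed_count_eq:
  "signed_count M n m =
     (if (n, m, 1) \<in> verts (quiver M) then 1 else 0) - (if (n, m, -1) \<in> verts (quiver M) then 1 else 0)"
proof -
  have "{j. j \<in> {-1, 1} \<and> (n, m, j) \<in> verts (quiver M)} =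
      (if (n, m, 1) \<in> verts (quiver M) then {1} else {}) \<union> (if (n, m, -1) \<in> verts (quiver M) then {-1} else {})"
    by auto
  then show ?thesis unfolding signed_count_def by simp
qed

lemma (in tree_pair) subnetwork_vertex:
  assumes "subnetwork M N2" "(n, m, j) \<in> verts (quiver M)"
  shows "n \<in> verts T1" "m \<in> verts T2" "on_vert F1 n = on_vert F2 m" "j \<in> {-1, 1}"
proof -
  have "(n, m, j) \<in> verts (quiver N2)"
    using assms by (auto simp: subnetwork_def subgraph_def)
  then show "n \<in> verts T1" "m \<in> verts T2" "on_vert F1 n = on_vert F2 m" "j \<in> {-1, 1}"
    by (auto simp: covering_network_def pullback_network_def Let_def)
qed

lemma (in tree_pair) associated_map_eq_matrix_map:
  assumes M: "subnetwork M N2"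
  shows "associated_map T1 M = (matrix_map T1 (\<lambda>n m. of_int (signed_count M n m)) :: _ \<Rightarrow> _ \<Rightarrow> 'k::field)"
proof -
  let ?V = "verts (quiver M)"
  have "?V \<subseteq> verts T1 \<times> verts T2 \<times> {-1, 1}"
    by (auto dest: subnetwork_vertex[OF M])
  then have fin: "finite ?V"
    by (rule finite_subset) simp
  have "(\<Sum>x\<in>{x \<in> ?V. fst x = n}. of_int (snd (snd x)) * basis_elem (fst (snd x)) m) =
      (of_int (signed_count M n m) :: 'k)" for n m
  proof -
    let ?J = "{j. j \<in> {-1, 1} \<and> (n, m, j) \<in> ?V}"
    have "(\<Sum>x\<in>{x \<in> ?V. fst x = n}. of_int (snd (snd x)) * basis_elem (fst (snd x)) m :: 'k) =
        (\<Sum>x\<in>{x \<in> ?V. fst x = n}. if fst (snd x) = m then of_int (snd (snd x)) else 0)"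
      by (intro sum.cong) (auto simp: basis_elem_def)
    also have "\<dots> = (\<Sum>x\<in>{x \<in> {x \<in> ?V. fst x = n}. fst (snd x) = m}. of_int (snd (snd x)))"
      using fin by (intro sum.inter_filter[symmetric]) simp
    also have "{x \<in> {x \<in> ?V. fst x = n}. fst (snd x) = m} = (\<lambda>j. (n, m, j)) ` ?J"
      by (auto dest: subnetwork_vertex(4)[OF M])
    also have "(\<Sum>x\<in>(\<lambda>j. (n, m, j)) ` ?J. of_int (snd (snd x)) :: 'k) = (\<Sum>j\<in>?J. of_int j)"
      by (subst sum.reindex) (auto simp: inj_on_def)
    finally show ?thesis by (simp add: signed_count_def)
  qed
  then show ?thesis
    by (auto simp: associated_map_def matrix_map_def fun_eq_iff sum_fun_apply vscale_def case_prod_beta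
        split: prod.splits)
qed

locale complete_free_network = tree_pair T1 T2 Q F1 F2
  for T1 :: "('n, 'e) pre_digraph" and T2 :: "('m, 'f) pre_digraph" and Q :: "('q, 'a) pre_digraph"
    and F1 :: "('n, 'e, 'q, 'a) quiver_map" and F2 :: "('m, 'f, 'q, 'a) quiver_map" +
  fixes M :: "('n \<times> 'm \<times> int, 'e \<times> 'f \<times> int) network"
  assumes sub: "subnetwork M N2" and complete: "complete_network T1 F1 T2 M"
    and free: "traversals M \<inter> triangle_traversals2 T1 F1 T2 F2 = {}"
begin

abbreviation V :: "('n \<times> 'm \<times> int) set" where
  "V \<equiv> verts (quiver M)"

text \<open>The form in which freeness is applied: with \<open>v\<close> as the middle of a walk,
  two different neighbours of \<open>v\<close> in \<open>M\<close> never lie in a common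
  clique.\<close>

lemma not_adjacent_N1:
  "adjacent M v u \<Longrightarrow> adjacent M v w \<Longrightarrow> u \<noteq> w \<Longrightarrow> \<not> adjacent N1 (proj u) (proj w)"
  using free triangle_free_iff[OF sub] adjacent_sym[of M v u] by blast

lemma joins_M_Arrow:
  "joins M (Arrow (a, b, j)) x y \<longleftrightarrow>
     (a, b, j) \<in> arcs (quiver M) \<and> x = (tail T1 a, tail T2 b, j) \<and> y = (head T1 a, head T2 b, j)"
proof -
  have "tail (quiver M) = tail (quiver N2)" "head (quiver M) = head (quiver N2)"
    using sub by (simp_all add: subnetwork_def subgraph_def compatible_def)
  then show ?thesis by (auto simp: covering_network_def Let_def)
qed

lemma arc_M:
  assumes "(a, b, j) \<in> arcs (quiver M)"
  shows "a \<in> arcs T1" "b \<in> arcs T2" "on_arr F1 a = on_arr F2 b" "j \<in> {-1, 1}"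
    "adjacent M (tail T1 a, tail T2 b, j) (head T1 a, head T2 b, j)"
    "(tail T1 a, tail T2 b, j) \<in> V" "(head T1 a, head T2 b, j) \<in> V"
proof -
  have l: "joins M (Arrow (a, b, j)) (tail T1 a, tail T2 b, j) (head T1 a, head T2 b, j)"
    using assms joins_M_Arrow by blast
  then have "joins N2 (Arrow (a, b, j)) (tail T1 a, tail T2 b, j) (head T1 a, head T2 b, j)"
    by (rule joins_subnetwork[OF sub])
  then show "a \<in> arcs T1" "b \<in> arcs T2" "on_arr F1 a = on_arr F2 b" "j \<in> {-1, 1}"
    by (auto simp: joins_N2_Arrow simp del: joins.simps)
  show "adjacent M (tail T1 a, tail T2 b, j) (head T1 a, head T2 b, j)"
    using l unfolding adjacent_def by blast
  show "(tail T1 a, tail T2 b, j) \<in> V" "(head T1 a, head T2 b, j) \<in> V"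
    using joins_in_verts[OF _ l] sub by (auto simp: subnetwork_def)
qed

lemma edge_M:
  assumes "{x, y} \<in> edges M"
  shows "adjacent M x y" "adjacent M y x" "x \<in> V" "y \<in> V"
proof -
  have l: "joins M (Edge {x, y}) x y" using assms by simp
  show "adjacent M x y" using l unfolding adjacent_def by blast
  then show "adjacent M y x" by (rule adjacent_sym)
  show "x \<in> V" "y \<in> V"
    using joins_in_verts[OF _ l] sub by (auto simp: subnetwork_def)
qed

lemma adjacent_N1_child:
  "a \<in> arcs T1 \<Longrightarrow> b \<in> arcs T2 \<Longrightarrow> on_arr F1 a = on_arr F2 b \<Longrightarrow>
    adjacent N1 (tail T1 a, tail T2 b) (head T1 a, head T2 b)"
  unfolding adjacent_def using joins_N1_Arrow by blast

lemma adjacent_N1_sibling: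
  assumes "a \<in> arcs T1" "a' \<in> arcs T1" "tail T1 a = tail T1 a'" "on_arr F1 a = on_arr F1 a'"
    "head T1 a \<noteq> head T1 a'" "(head T1 a, m, j) \<in> V"
  shows "adjacent N1 (head T1 a, m) (head T1 a', m)"
proof -
  have "{(head T1 a, m), (head T1 a', m)} \<in> edges N1"
    using assms subnetwork_vertex[OF sub assms(6)] unfolding edge_N1_iff by blast
  then have "joins N1 (Edge {(head T1 a, m), (head T1 a', m)}) (head T1 a, m) (head T1 a', m)" by simp
  then show ?thesis unfolding adjacent_def by blast
qed

text \<open>Arrows of \<open>M\<close> match every occurrence on the right with one on the left of
  the same sign. The remaining occurrences on the left are matched with each other by edges and
  cancel.\<close>

lemma sum_signed_count:
  "(\<Sum>a | a \<in> arcs T1 \<and> tail T1 a = n \<and> on_arr F1 a = \<gamma>. signed_count M (head T1 a) m) =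
   (\<Sum>b | b \<in> arcs T2 \<and> head T2 b = m \<and> on_arr F2 b = \<gamma>. signed_count M n (tail T2 b))"
proof -
  define C where "C = {a. a \<in> arcs T1 \<and> tail T1 a = n \<and> on_arr F1 a = \<gamma>}"
  define B where "B = {b. b \<in> arcs T2 \<and> head T2 b = m \<and> on_arr F2 b = \<gamma>}"
  \<comment> \<open>\<open>S\<close> and \<open>R\<close> are the occurrences in \<open>V\<close> of
    the pairs on the left and on the right, with their signs; \<open>W\<close> consists of the
    arrows of \<open>M\<close> between them.\<close>
  define S where "S = (SIGMA a:C. {j. j \<in> {-1, 1} \<and> (head T1 a, m, j) \<in> V})"
  define R where "R = (SIGMA b:B. {j. j \<in> {-1, 1} \<and> (n, tail T2 b, j) \<in> V})"
  define W where "W = {(a, b, j). (a, b, j) \<in> arcs (quiver M) \<and> a \<in> C \<and> b \<in> B}"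
  have fin: "finite C" "finite B" by (simp_all add: C_def B_def)
  have finS: "finite S"
    unfolding S_def using fin by (intro finite_SigmaI) (auto intro: finite_subset[of _ "{-1, 1}"])
  have sumS: "(\<Sum>a\<in>C. signed_count M (head T1 a) m) = (\<Sum>x\<in>S. snd x)"
    unfolding signed_count_def S_def using fin by (subst sum.Sigma) (auto simp: case_prod_beta)
  have sumR: "(\<Sum>b\<in>B. signed_count M n (tail T2 b)) = (\<Sum>x\<in>R. snd x)"
    unfolding signed_count_def R_def using fin by (subst sum.Sigma) (auto simp: case_prod_beta)
  let ?p = "\<lambda>(a, b, j). (a, j)" and ?q = "\<lambda>(a, b, j). (b, j)"
  have B1: "b = b'" if "b \<in> B" "b' \<in> B" for b b'
    using that B.in_arc_unique by (auto simp: B_def)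
  have inj_p: "inj_on ?p W"
    using B1 by (auto simp: inj_on_def W_def)
  \<comment> \<open>Two arrows of \<open>M\<close> from one vertex to siblings over the same
    \<open>m\<close> would span a triangle.\<close>
  have "a = a'" if w: "(a, b, j) \<in> W" "(a', b, j) \<in> W" for a a' b j
  proof (rule ccontr)
    assume "a \<noteq> a'"
    then have ne: "head T1 a \<noteq> head T1 a'"
      using w A.in_arc_unique by (auto simp: W_def C_def)
    note w1 = arc_M[of a b j] and w2 = arc_M[of a' b j]
    have "adjacent N1 (head T1 a, head T2 b) (head T1 a', head T2 b)"
      using w w1 w2 ne by (intro adjacent_N1_sibling) (auto simp: W_def C_def)
    moreover have "tail T1 a = tail T1 a'" using w by (simp add: W_def C_def)
    ultimately show False
      using not_adjacent_N1[of "(tail T1 a, tail T2 b, j)" "(head T1 a, head T2 b, j)" "(head T1 a', head T2 b, j)"]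
        w w1(5) w2(5) ne by (auto simp: W_def proj_def)
  qed
  then have inj_q: "inj_on ?q W"
    by (auto simp: inj_on_def)
  have pW: "?p ` W \<subseteq> S"
    using arc_M by (fastforce simp: W_def S_def B_def)
  \<comment> \<open>Surjectivity is the second clause of completeness: every arrow of
    \<open>T2\<close> leaving the second coordinate is lifted.\<close>
  have qW: "?q ` W = R"
  proof
    show "?q ` W \<subseteq> R"
      using arc_M by (fastforce simp: W_def R_def C_def)
    show "R \<subseteq> ?q ` W"
    proof
      fix x assume "x \<in> R"
      then obtain b j where x: "x = (b, j)" "b \<in> B" "(n, tail T2 b, j) \<in> V"
        by (auto simp: R_def)
      then obtain a where "tail T1 a = n" "(a, b, j) \<in> arcs (quiver M)"
        using complete unfolding complete_network_def by (fastforce simp: B_def)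
      then have "(a, b, j) \<in> W"
        using x arc_M[of a b j] by (auto simp: W_def C_def B_def)
      then show "x \<in> ?q ` W" using x(1) by force
    qed
  qed
  \<comment> \<open>The occurrences on the left that no arrow of \<open>M\<close> enters. The first
    clause of completeness gives each of them an edge; freeness makes the partner unique and keeps
    it in the same set.\<close>
  let ?S' = "S - ?p ` W"
  define E where "E a j a' \<longleftrightarrow> a' \<in> C \<and> {(head T1 a, m, j), (head T1 a', m, -j)} \<in> edges M" for a a' and j :: int
  have E_sym: "E a' (-j) a" if "E a j a'" "a \<in> C" for a a' j
    using that by (simp add: E_def insert_commute)
  have E_unique: "a' = a''" if "E a j a'" "E a j a''" "a \<in> C" for a a' a'' j
  proof (rule ccontr)
    assume "a' \<noteq> a''"
    then have ne: "head T1 a' \<noteq> head T1 a''"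
      using that A.in_arc_unique by (auto simp: E_def C_def)
    have e: "{(head T1 a, m, j), (head T1 a', m, -j)} \<in> edges M" "{(head T1 a, m, j), (head T1 a'', m, -j)} \<in> edges M"
      using that by (auto simp: E_def)
    have "adjacent N1 (head T1 a', m) (head T1 a'', m)"
      using that ne edge_M(4)[OF e(1)] by (intro adjacent_N1_sibling) (auto simp: E_def C_def)
    then show False
      using not_adjacent_N1[OF edge_M(1)[OF e(1)] edge_M(1)[OF e(2)]] ne by (simp add: proj_def)
  qed
  have E_ex: "\<exists>a'. E a j a' \<and> (a', -j) \<in> ?S'" if x: "(a, j) \<in> ?S'" for a j
  proof -
    have a: "a \<in> C" "(head T1 a, m, j) \<in> V" "j \<in> {-1, 1}" using x by (auto simp: S_def)
    have "\<not> (\<exists>b\<in>arcs T2. head T2 b = m \<and> (a, b, j) \<in> arcs (quiver M))"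
    proof
      assume "\<exists>b\<in>arcs T2. head T2 b = m \<and> (a, b, j) \<in> arcs (quiver M)"
      then obtain b where "head T2 b = m" "(a, b, j) \<in> arcs (quiver M)" by blast
      then have "(a, b, j) \<in> W"
        using a arc_M[of a b j] by (auto simp: W_def B_def C_def)
      then show False using x by force
    qed
    then obtain a' where a': "a' \<in> arcs T1" "tail T1 a' = tail T1 a" "on_arr F1 a = on_arr F1 a'"
      "(head T1 a', m, -j) \<in> V" "{(head T1 a, m, j), (head T1 a', m, -j)} \<in> edges M"
      using complete a unfolding complete_network_def by (fastforce simp: C_def)
    then have E: "E a j a'" using a by (auto simp: E_def C_def)
    \<comment> \<open>If an arrow entered the partner, its tail and \<open>(head T1 a, m, j)\<close>
      would be two neighbours of the partner in one clique; they are different because their signs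
      are.\<close>
    have "(a', -j) \<notin> ?p ` W"
    proof
      assume "(a', -j) \<in> ?p ` W"
      then obtain b where b: "(a', b, -j) \<in> arcs (quiver M)" "b \<in> B" by (auto simp: W_def)
      have bm: "head T2 b = m" "on_arr F2 b = \<gamma>" using b by (auto simp: B_def)
      have up: "adjacent M (head T1 a', m, -j) (tail T1 a', tail T2 b, -j)"
        using arc_M(5)[OF b(1)] bm by (simp add: adjacent_sym)
      have side: "adjacent M (head T1 a', m, -j) (head T1 a, m, j)"
        using edge_M(2)[OF a'(5)] .
      have "adjacent N1 (tail T1 a', tail T2 b) (head T1 a, m)"
        using adjacent_N1_child[of a b] a a' b bm arc_M[OF b(1)] by (auto simp: C_def)
      moreover have "j \<noteq> -j" using a by auto
      ultimately show False
        using not_adjacent_N1[OF up side] by (auto simp: proj_def)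
    qed
    then have "(a', -j) \<in> ?S'"
      using E a a' by (auto simp: S_def E_def)
    then show ?thesis using E by blast
  qed
  define \<sigma> where "\<sigma> = (\<lambda>(a, j). (SOME a'. E a j a' \<and> (a', -j) \<in> ?S', -j))"
  have \<sigma>: "E a j (fst (\<sigma> (a, j))) \<and> \<sigma> (a, j) \<in> ?S' \<and> snd (\<sigma> (a, j)) = -j" if "(a, j) \<in> ?S'" for a j
    using someI_ex[OF E_ex[OF that]] by (simp add: \<sigma>_def)
  have \<sigma>\<sigma>: "\<sigma> (\<sigma> x) = x" if "x \<in> ?S'" for x
  proof -
    obtain a j where x: "x = (a, j)" by (cases x)
    define a' where "a' = fst (\<sigma> (a, j))"
    have a': "\<sigma> (a, j) = (a', -j)" "E a j a'" "(a', -j) \<in> ?S'"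
      using \<sigma>[of a j] that unfolding x a'_def by (metis prod.collapse)+
    define a'' where "a'' = fst (\<sigma> (a', -j))"
    have a'': "\<sigma> (a', -j) = (a'', j)" "E a' (-j) a''"
      using \<sigma>[OF a'(3)] unfolding a''_def by (metis prod.collapse minus_minus)+
    have "a \<in> C" "a' \<in> C" using that x a' by (auto simp: S_def)
    then have "a'' = a"
      using E_unique[OF a''(2) E_sym[OF a'(2)]] by blast
    then show ?thesis using a' a'' x by simp
  qed
  have \<sigma>_mem: "\<sigma> x \<in> ?S'" "snd (\<sigma> x) = - snd x" if "x \<in> ?S'" for x
    using \<sigma>[of "fst x" "snd x"] that by simp_all
  \<comment> \<open>\<open>\<sigma>\<close> is a sign-reversing involution. The signs are summed in
    the integers, where a sum equal to its negative is 0; the passage to the field comes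
    afterwards.\<close>
  have "(\<Sum>x\<in>?S'. snd x) = (\<Sum>x\<in>?S'. - snd x)"
    by (rule sum.reindex_bij_witness[of _ \<sigma> \<sigma>]) (simp_all only: \<sigma>\<sigma> \<sigma>_mem minus_minus)
  then have "(\<Sum>x\<in>?S'. snd x) = 0"
    by (simp add: sum_negf)
  then have "(\<Sum>x\<in>S. snd x) = (\<Sum>x\<in>?p ` W. snd x)"
    using sum.subset_diff[OF pW finS, of snd] by simp
  also have "\<dots> = (\<Sum>x\<in>W. snd (snd x))"
    using inj_p by (subst sum.reindex) (auto simp: case_prod_beta)
  also have "\<dots> = (\<Sum>x\<in>?q ` W. snd x)"
    using inj_q by (subst sum.reindex) (auto simp: case_prod_beta)
  finally show ?thesis
    using sumS sumR qW by (simp add: C_def B_def)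
qed

lemma hom_matrix_signed_count:
  "hom_matrix T1 F1 T2 F2 (\<lambda>n m. of_int (signed_count M n m) :: 'k::field)"
proof -
  have "n \<in> verts T1 \<and> m \<in> verts T2 \<and> on_vert F1 n = on_vert F2 m"
    if nz: "(of_int (signed_count M n m) :: 'k) \<noteq> 0" for n m
  proof -
    obtain j where "(n, m, j) \<in> V"
      using nz by (auto simp: signed_count_eq split: if_splits)
    then show ?thesis using subnetwork_vertex[OF sub] by blast
  qed
  then show ?thesis
    using sum_signed_count unfolding hom_matrix_def by (simp flip: of_int_sum)
qed

end

section \<open>Ghosts\<close>

lemma (in arborescence) wf_arcs_ends: "wf (arcs_ends T)"
  using acyclic_ends by (intro finite_acyclic_wf) (simp add: arcs_ends_def)

context complete_free_network begin

lemma adjacent_M_cases: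
  assumes "adjacent M x y"
  obtains (down) a b j where "(a, b, j) \<in> arcs (quiver M)" "x = (tail T1 a, tail T2 b, j)" "y = (head T1 a, head T2 b, j)"
    | (up) a b j where "(a, b, j) \<in> arcs (quiver M)" "y = (tail T1 a, tail T2 b, j)" "x = (head T1 a, head T2 b, j)"
    | (edge) "{x, y} \<in> edges M"
proof -
  obtain l where l: "joins M l x y" using assms by (auto simp: adjacent_def)
  show ?thesis
  proof (cases l)
    case (Arrow t)
    then show ?thesis using l down joins_M_Arrow by (cases t) blast
  next
    case (Inverse t)
    then have "joins M (Arrow t) y x" using l by simp
    then show ?thesis using up joins_M_Arrow by (cases t) blast
  next
    case (Edge e)
    then show ?thesis using l edge by (metis joins.simps(3))
  qed
qed

lemma edge_M_siblings:
  assumes "{(n, m, j), (n', m', j')} \<in> edges M"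
  shows "m' = m" "j' = -j" "n \<noteq> n'"
    "\<exists>a\<in>arcs T1. \<exists>a'\<in>arcs T1. head T1 a = n \<and> head T1 a' = n' \<and> tail T1 a = tail T1 a' \<and>
       on_arr F1 a = on_arr F1 a'"
proof -
  have "{(n, m, j), (n', m', j')} \<in> edges N2"
    using assms sub by (auto simp: subnetwork_def)
  then show "m' = m" "j' = -j" "n \<noteq> n'"
    "\<exists>a\<in>arcs T1. \<exists>a'\<in>arcs T1. head T1 a = n \<and> head T1 a' = n' \<and> tail T1 a = tail T1 a' \<and>
       on_arr F1 a = on_arr F1 a'"
    unfolding edge_N2_iff edge_N1_iff by blast+
qed

text \<open>
  A connected \<open>M\<close> grows downwards by arrows from one vertex, or one edge, over a minimal vertex of
  \<open>T2\<close>; since a directed path changes the vertex of \<open>T2\<close>, that vertex occurs with one sign only.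
\<close>

lemma unpaired_vertex:
  assumes conn: "connected_network M" and "V \<noteq> {}"
  shows "\<exists>n m j. (n, m, j) \<in> V \<and> (n, m, -j) \<notin> V"
proof -
  define down where "down = {((tail T1 a, tail T2 b, j), (head T1 a, head T2 b, j)) | a b j.
    (a, b, j) \<in> arcs (quiver M)}"
  \<comment> \<open>Minimality of \<open>m0\<close> among the second coordinates keeps arrows of
    \<open>M\<close> from entering a vertex over \<open>m0\<close>.\<close>
  obtain m0 where m0: "m0 \<in> (\<lambda>x. fst (snd x)) ` V"
    "\<And>m. (m, m0) \<in> arcs_ends T2 \<Longrightarrow> m \<notin> (\<lambda>x. fst (snd x)) ` V"
    using wfE_min[OF B.wf_arcs_ends] \<open>V \<noteq> {}\<close> by (metis all_not_in_conv image_is_empty)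
  obtain n0 j0 where x0: "(n0, m0, j0) \<in> V" using m0(1) by auto
  have j0: "j0 \<noteq> -j0" using subnetwork_vertex(4)[OF sub x0] by auto
  define top where "top = {x. x = (n0, m0, j0) \<or> {(n0, m0, j0), x} \<in> edges M}"
  define D where "D = down\<^sup>* `` top"
  have top: "fst (snd x) = m0" if "x \<in> top" for x
    using that edge_M_siblings(1)[of n0 m0 j0 "fst x" "fst (snd x)" "snd (snd x)"] by (auto simp: top_def)
  \<comment> \<open>\<open>D\<close> is closed under every kind of link of \<open>M\<close>, so
    connectedness will put all of \<open>V\<close> into it.\<close>
  have step: "y \<in> D" if x: "x \<in> D" and adj: "adjacent M x y" for x y
  proof -
    obtain t where t: "t \<in> top" "(t, x) \<in> down\<^sup>*" using x by (auto simp: D_def)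
    show ?thesis
      using adj
    proof (cases rule: adjacent_M_cases)
      case (down a b j)
      then have "(x, y) \<in> down" by (auto simp: down_def)
      then show ?thesis using t unfolding D_def by (meson ImageI rtrancl.rtrancl_into_rtrancl)
    next
      \<comment> \<open>Going up from \<open>top\<close> contradicts the minimality of
        \<open>m0\<close>. Further down, both coordinates have only one incoming arrow, so going up
        retraces the last step of the descent.\<close>
      case (up a b j)
      note ab = arc_M[OF up(1)]
      show ?thesis
        using t(2)
      proof (cases rule: rtranclE)
        case base
        then have "head T2 b = m0" using top[OF t(1)] up by simp
        then have "(tail T2 b, m0) \<in> arcs_ends T2" using arc_T2[OF ab(2)] by simp
        then have "tail T2 b \<notin> (\<lambda>x. fst (snd x)) ` V" by (rule m0(2))
        then show ?thesis using ab(6) by force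
      next
        case (step z)
        then obtain a' b' where z: "(a', b', j) \<in> arcs (quiver M)" "z = (tail T1 a', tail T2 b', j)"
          "head T1 a' = head T1 a" "head T2 b' = head T2 b"
          using up by (auto simp: down_def)
        then have "a' = a" "b' = b"
          using ab arc_M[OF z(1)] A.in_arc_unique B.in_arc_unique by auto
        then show ?thesis using step t z up by (auto simp: D_def)
      qed
    next
      case edge
      obtain n m j n' m' j' where xy: "x = (n, m, j)" "y = (n', m', j')" by (cases x; cases y) auto
      note e = edge_M_siblings[OF edge[unfolded xy]]
      obtain a a' where a: "a \<in> arcs T1" "a' \<in> arcs T1" "head T1 a = n" "head T1 a' = n'"
        "tail T1 a = tail T1 a'" "on_arr F1 a = on_arr F1 a'"
        using e(4) by blast
      show ?thesis
        using t(2)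
      proof (cases rule: rtranclE)
        case base
        show ?thesis
        proof (cases "x = (n0, m0, j0)")
          case True
          then show ?thesis using edge by (auto simp: D_def top_def)
        next
          case False
          then have e0: "{(n0, m0, j0), x} \<in> edges M" using base t by (auto simp: top_def)
          \<comment> \<open>A second edge at the partner would lead to a third sibling and hence
            complete a triangle.\<close>
          have "y = (n0, m0, j0)"
          proof (rule ccontr)
            assume ne: "y \<noteq> (n0, m0, j0)"
            note e0' = edge_M_siblings[OF e0[unfolded xy]]
            obtain a0 where a0: "a0 \<in> arcs T1" "head T1 a0 = n0" "tail T1 a0 = tail T1 a" "on_arr F1 a0 = on_arr F1 a"
              using e0'(4) a A.in_arc_unique by metis
            have "n' \<noteq> n0" using ne xy e e0' by auto
            then have "adjacent N1 (n0, m0) (n', m0)"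
              using adjacent_N1_sibling[of a0 a' m0 j0] a a0 x0 by auto
            then show False
              using not_adjacent_N1[OF edge_M(2)[OF e0] edge_M(1)[OF edge] ne[symmetric]] xy e e0'
              by (simp add: proj_def)
          qed
          then show ?thesis by (auto simp: D_def top_def)
        qed
      next
        \<comment> \<open>Here \<open>x\<close> was entered by an arrow from \<open>z\<close>; an
          edge from \<open>x\<close> to \<open>y\<close> would put \<open>z\<close> and
          \<open>y\<close> into one clique, so this case is contradictory.\<close>
        case (step z)
        then obtain a1 b1 where z: "(a1, b1, j) \<in> arcs (quiver M)" "z = (tail T1 a1, tail T2 b1, j)"
          "head T1 a1 = n" "head T2 b1 = m"
          using xy by (auto simp: down_def)
        note ab = arc_M[OF z(1)]
        have "a1 = a" using ab a z A.in_arc_unique by auto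
        then have "adjacent N1 (proj z) (proj y)"
          using adjacent_N1_child[of a' b1] a ab z xy e by (simp add: proj_def)
        moreover have "z \<noteq> y"
          using no_loop_T2[OF ab(2)] z xy e by auto
        moreover have "adjacent M x z"
          using adjacent_sym[OF ab(5)] z xy by simp
        ultimately show ?thesis
          using not_adjacent_N1[of x z y] edge_M(1)[OF edge] by blast
      qed
    qed
  qed
  have "w \<in> D" if "link_walk M u ls w" "u \<in> D" for u ls w
    using that
  proof (induction ls arbitrary: u)
    case (Cons l ls)
    then obtain v where "joins M l u v" "link_walk M v ls w" by auto
    then show ?case using Cons step[of u v] unfolding adjacent_def by blast
  qed simp
  moreover have "(n0, m0, j0) \<in> D" by (auto simp: D_def top_def)
  ultimately have "V \<subseteq> D"
    using conn x0 unfolding connected_network_def traversal_def by blast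
  \<comment> \<open>Partners in \<open>top\<close> differ from \<open>n0\<close> in the first
    coordinate, and a proper descent leaves \<open>m0\<close> for good.\<close>
  have "(n0, m0, -j0) \<notin> D"
  proof
    assume "(n0, m0, -j0) \<in> D"
    then obtain t where t: "t \<in> top" "(t, (n0, m0, -j0)) \<in> down\<^sup>*" by (auto simp: D_def)
    have trancl: "(fst (snd x), fst (snd y)) \<in> (arcs_ends T2)\<^sup>+" if "(x, y) \<in> down\<^sup>+" for x y
      using that
    proof (induction rule: trancl_induct)
      case (base y)
      then show ?case using arc_M(2) arc_T2 by (fastforce simp: down_def)
    next
      case (step y z)
      then have "(fst (snd y), fst (snd z)) \<in> arcs_ends T2"
        using arc_M(2) arc_T2 by (fastforce simp: down_def)
      then show ?case using step.IH by simp
    qed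
    show False
    proof (cases "t = (n0, m0, -j0)")
      case True
      then show ?thesis
        using t j0 edge_M_siblings(3)[of n0 m0 j0 n0 m0 "-j0"] by (auto simp: top_def)
    next
      case False
      then have "(t, (n0, m0, -j0)) \<in> down\<^sup>+" using t by (simp add: rtrancl_eq_or_trancl)
      then show ?thesis using trancl[of t "(n0, m0, -j0)"] top[OF t(1)] no_cycle_T2 by simp
    qed
  qed
  then show ?thesis using x0 \<open>V \<subseteq> D\<close> by blast
qed

text \<open>Nothing cancels at an unpaired vertex: the entry there is 1 or -1, hence nonzero in the
  field.\<close>

lemma associated_map_nonzero:
  assumes "connected_network M" "V \<noteq> {}"
  shows "associated_map T1 M \<noteq> (0 :: ('n \<Rightarrow> 'k::field) \<Rightarrow> 'm \<Rightarrow> 'k)"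
proof
  assume "associated_map T1 M = (0 :: ('n \<Rightarrow> 'k) \<Rightarrow> 'm \<Rightarrow> 'k)"
  then have zero_map: "matrix_map T1 (\<lambda>n m. of_int (signed_count M n m)) = (0 :: ('n \<Rightarrow> 'k) \<Rightarrow> 'm \<Rightarrow> 'k)"
    using associated_map_eq_matrix_map[OF sub, where 'k = 'k] by simp
  obtain n m j where nm: "(n, m, j) \<in> V" "(n, m, -j) \<notin> V"
    using unpaired_vertex[OF assms] by blast
  have "(of_int (signed_count M n m) :: 'k) = 0"
    using matrix_map_basis_elem[of T1 n "\<lambda>n m. of_int (signed_count M n m) :: 'k" m]
      subnetwork_vertex(1)[OF sub nm(1)] zero_map by simp
  moreover have "signed_count M n m = j" "j \<in> {-1, 1}"
    using nm subnetwork_vertex(4)[OF sub nm(1)] by (auto simp: signed_count_eq)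
  ultimately show False by auto
qed

end

lemma (in tree_pair) ghost_free: "ghost_free TYPE('k::field) T1 F1 T2 F2"
  unfolding ghost_free_def ghost_def complete_connected_free_def
proof (intro notI, elim exE conjE)
  fix M assume M: "subnetwork M N2" "verts (quiver M) \<noteq> {}" "complete_network T1 F1 T2 M"
    "connected_network M" "traversals M \<inter> triangle_traversals2 T1 F1 T2 F2 = {}"
    and zero_map: "associated_map T1 M = (0 :: ('n \<Rightarrow> 'k) \<Rightarrow> 'm \<Rightarrow> 'k)"
  interpret complete_free_network T1 T2 Q F1 F2 M
    using M by unfold_locales
  show False using associated_map_nonzero M zero_map by blast
qed

section \<open>Generalized graph maps inside a support\<close>

text \<open>Prepending \<open>l\<close> creates a forbidden turn only if the traversal starts by
  undoing \<open>l\<close>; dropping that first link then leaves a traversal from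
  \<open>w\<close>.\<close>

lemma traversal_extend:
  assumes "is_network N" "joins N l w u" "traversal N u ls v"
  shows "\<exists>ls'. traversal N w ls' v"
proof (cases "ls \<noteq> [] \<and> hd ls = link_inv l")
  case True
  then obtain ls' where ls: "ls = link_inv l # ls'" by (cases ls) auto
  then obtain x where x: "joins N (link_inv l) u x" "link_walk N x ls' v"
    using assms(3) by (auto simp: traversal_def)
  have "x = w"
    using joins_target[OF x(1) joins_inv[OF assms(2)]] .
  then have "traversal N w ls' v"
    using x assms(3) ls by (auto simp: traversal_def successively_Cons)
  then show ?thesis by blast
next
  case False
  then have "traversal N w (l # ls) v"
    using assms by (cases ls) (auto simp: traversal_def successively_Cons)
  then show ?thesis by blast
qed

lemma connected_networkI:
  assumes N: "is_network N" and r: "\<And>v. v \<in> verts (quiver N) \<Longrightarrow> (adjacent N)\<^sup>*\<^sup>* r v"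
  shows "connected_network N"
  unfolding connected_network_def
proof (intro ballI)
  fix u v assume uv: "u \<in> verts (quiver N)" "v \<in> verts (quiver N)"
  have "symp (adjacent N)" by (auto intro!: sympI adjacent_sym)
  then have "(adjacent N)\<^sup>*\<^sup>* u r" using r[OF uv(1)] by (metis symp_rtranclp sympD)
  then have "(adjacent N)\<^sup>*\<^sup>* u v" using r[OF uv(2)] by (rule rtranclp_trans)
  then show "\<exists>ls. traversal N u ls v"
  proof (induction rule: converse_rtranclp_induct)
    case base
    have "traversal N v [] v" using uv by (simp add: traversal_def)
    then show ?case by blast
  next
    case (step x y)
    then show ?case using traversal_extend[OF N] unfolding adjacent_def by blast
  qed
qed

text \<open>
  A generalized graph map inside the set \<open>P\<close>: it starts from the vertex, or the edge, \<open>I\<close> over \<open>m0\<close>, and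
  below \<open>(n, tail T2 b)\<close> it follows the pair of arrows \<open>(c n b, b)\<close>.
\<close>

locale descent = tree_pair T1 T2 Q F1 F2
  for T1 :: "('n, 'e) pre_digraph" and T2 :: "('m, 'f) pre_digraph" and Q :: "('q, 'a) pre_digraph"
    and F1 :: "('n, 'e, 'q, 'a) quiver_map" and F2 :: "('m, 'f, 'q, 'a) quiver_map" +
  fixes P :: "'n \<Rightarrow> 'm \<Rightarrow> bool" and c :: "'n \<Rightarrow> 'f \<Rightarrow> 'e" and I :: "('n \<times> 'm \<times> int) set" and m0 :: 'm
  assumes P_vertex: "P n m \<Longrightarrow> n \<in> verts T1 \<and> m \<in> verts T2 \<and> on_vert F1 n = on_vert F2 m"
    and choice: "P n (tail T2 b) \<Longrightarrow> b \<in> arcs T2 \<Longrightarrow> c n b \<in> arcs T1 \<and> tail T1 (c n b) = n \<and>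
      on_arr F1 (c n b) = on_arr F2 b \<and> P (head T1 (c n b)) (head T2 b)"
    and I_P: "(n, m, j) \<in> I \<Longrightarrow> P n m"
    and I_cases: "(\<exists>n. I = {(n, m0, 1)} \<and> in_arcs T1 n = {}) \<or>
      (\<exists>a\<in>arcs T1. \<exists>a'\<in>arcs T1. I = {(head T1 a, m0, 1), (head T1 a', m0, -1)} \<and>
         tail T1 a = tail T1 a' \<and> on_arr F1 a = on_arr F1 a' \<and> head T1 a \<noteq> head T1 a')"
begin

inductive_set D :: "('n \<times> 'm \<times> int) set" where
  init: "x \<in> I \<Longrightarrow> x \<in> D"
| step: "(n, tail T2 b, j) \<in> D \<Longrightarrow> b \<in> arcs T2 \<Longrightarrow> (head T1 (c n b), head T2 b, j) \<in> D"

text \<open>The condition \<open>card e = 2\<close> makes \<open>I\<close> itself the edge when it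
  is a pair and leaves no edge when it is a single vertex.\<close>

definition G :: "('n \<times> 'm \<times> int, 'e \<times> 'f \<times> int) network" where
  "G = \<lparr> quiver = \<lparr> verts = D, arcs = {(c n b, b, j) | n b j. b \<in> arcs T2 \<and> (n, tail T2 b, j) \<in> D},
      tail = tail (quiver N2), head = head (quiver N2) \<rparr>,
    edges = {e. e = I \<and> card e = 2} \<rparr>"

definition down :: "'n \<times> 'm \<times> int \<Rightarrow> 'n \<times> 'm \<times> int \<Rightarrow> bool" where
  "down x y \<longleftrightarrow> (\<exists>n b j. b \<in> arcs T2 \<and> (n, tail T2 b, j) \<in> D \<and> x = (n, tail T2 b, j) \<and>
     y = (head T1 (c n b), head T2 b, j))"

lemma I_sign: "(n, m, j) \<in> I \<Longrightarrow> m = m0 \<and> j \<in> {-1, 1}"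
  using I_cases by auto

lemma I_inj: "(n, m, j) \<in> I \<Longrightarrow> (n', m', j') \<in> I \<Longrightarrow> n = n' \<longleftrightarrow> j = j'"
  using I_cases by auto

lemma D_facts: "(n, m, j) \<in> D \<Longrightarrow> P n m \<and> j \<in> {-1, 1} \<and> (m0, m) \<in> (arcs_ends T2)\<^sup>*"
proof (induction "(n, m, j)" arbitrary: n m j rule: D.induct)
  case init
  then show ?case using I_P I_sign by blast
next
  case (step n b j)
  then have "(tail T2 b, head T2 b) \<in> arcs_ends T2" using arc_T2 by blast
  then show ?case using step choice by (meson rtrancl.rtrancl_into_rtrancl)
qed

lemma choice_D:
  assumes "(n, tail T2 b, j) \<in> D" "b \<in> arcs T2"
  shows "c n b \<in> arcs T1" "tail T1 (c n b) = n" "on_arr F1 (c n b) = on_arr F2 b"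
  using assms D_facts choice by blast+

lemma head_not_m0: "(n, tail T2 b, j) \<in> D \<Longrightarrow> b \<in> arcs T2 \<Longrightarrow> head T2 b \<noteq> m0"
  using D_facts[of n "tail T2 b" j] arc_T2[of b] no_cycle_T2 by (metis rtrancl_into_trancl1)

text \<open>By unique parents in \<open>T2\<close>, all descents to \<open>m\<close> use the same
  arrows from \<open>m0\<close> on, so different vertices of \<open>D\<close> over \<open>m\<close>
  stem from different vertices of \<open>I\<close>. Their first coordinates stay apart because
  \<open>n\<close> is the tail of \<open>c n b\<close>. One direction gives involution-freeness, the
  other a unique predecessor.\<close>

lemma D_inj: "(n, m, j) \<in> D \<Longrightarrow> (n', m, j') \<in> D \<Longrightarrow> n = n' \<longleftrightarrow> j = j'"
proof (induction "(n, m, j)" arbitrary: n m j n' j' rule: D.induct)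
  case init
  from init(2) show ?case
  proof (cases rule: D.cases)
    case init
    then show ?thesis using \<open>(n, m, j) \<in> I\<close> I_inj by blast
  next
    case (step n1 b)
    then show ?thesis using head_not_m0[of n1 b] I_sign[OF \<open>(n, m, j) \<in> I\<close>] by blast
  qed
next
  case (step n b j)
  from step.prems show ?case
  proof (cases rule: D.cases)
    case init
    then show ?thesis using head_not_m0 step.hyps I_sign by blast
  next
    case (step n1 b1)
    have "b1 = b" using step \<open>b \<in> arcs T2\<close> B.in_arc_unique by metis
    then have D1: "(n1, tail T2 b, j') \<in> D" "n' = head T1 (c n1 b)" using step by auto
    have "head T1 (c n b) = head T1 (c n1 b) \<longleftrightarrow> n = n1"
      using choice_D[OF D1(1)] choice_D[OF \<open>(n, tail T2 b, j) \<in> D\<close>] \<open>b \<in> arcs T2\<close> A.in_arc_unique by metis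
    then show ?thesis using \<open>\<And>n' j'. (n', tail T2 b, j') \<in> D \<Longrightarrow> (n = n') = (j = j')\<close> D1 by blast
  qed
qed

lemma N2_quiver [simp]:
  "tail (quiver N2) (a, b, j) = (tail T1 a, tail T2 b, j)"
  "head (quiver N2) (a, b, j) = (head T1 a, head T2 b, j)"
  by (simp_all add: covering_network_def Let_def)

lemma subnetwork_G: "subnetwork G N2"
proof -
  have verts: "verts (quiver G) \<subseteq> verts (quiver N2)"
    using D_facts P_vertex
    by (fastforce simp: G_def covering_network_def pullback_network_def Let_def)
  have arcs: "arcs (quiver G) \<subseteq> arcs (quiver N2)"
    using D_facts choice_D
    by (fastforce simp: G_def covering_network_def pullback_network_def Let_def)
  have wf: "wf_digraph (quiver G)"
    using choice_D by (auto simp: G_def intro!: wf_digraph.intro D.step)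
  have I_edge: "I \<in> edges N2" if "card I = 2"
  proof -
    obtain a a' where a: "a \<in> arcs T1" "a' \<in> arcs T1" "I = {(head T1 a, m0, 1), (head T1 a', m0, -1)}"
      "tail T1 a = tail T1 a'" "on_arr F1 a = on_arr F1 a'" "head T1 a \<noteq> head T1 a'"
      using I_cases \<open>card I = 2\<close> by auto
    then have "m0 \<in> verts T2 \<and> on_vert F1 (head T1 a) = on_vert F2 m0"
      using I_P P_vertex by blast
    then show ?thesis
      unfolding a(3) edge_N2_iff edge_N1_iff using a by auto
  qed
  then have "edges G \<subseteq> edges N2" by (auto simp: G_def)
  moreover have "is_network G"
    using wf by (auto simp: is_network_def G_def intro: D.init)
  ultimately show ?thesis
    using verts arcs wf is_network_N2
    by (auto simp: subnetwork_def subgraph_def compatible_def G_def is_network_def)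
qed

lemma down_arc: "down x y \<Longrightarrow> \<exists>t. joins G (Arrow t) x y"
  using choice_D unfolding down_def G_def by fastforce

lemma adjacent_G_iff:
  "adjacent G x y \<longleftrightarrow> down x y \<or> down y x \<or> card I = 2 \<and> I = {x, y}"
proof
  assume "adjacent G x y"
  then obtain l where l: "joins G l x y" by (auto simp: adjacent_def)
  show "down x y \<or> down y x \<or> card I = 2 \<and> I = {x, y}"
  proof (cases l)
    case (Arrow t) then show ?thesis using l choice_D by (auto simp: G_def down_def)
  next
    case (Inverse t) then show ?thesis using l choice_D by (auto simp: G_def down_def)
  next
    case (Edge e) then show ?thesis using l by (auto simp: G_def)
  qed
next
  assume "down x y \<or> down y x \<or> card I = 2 \<and> I = {x, y}"
  moreover have "joins G (Edge I) x y" if I: "card I = 2 \<and> I = {x, y}"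
  proof -
    have "I \<in> edges G" using conjunct1[OF I] by (simp add: G_def)
    then show ?thesis using I by (metis joins.simps(3))
  qed
  ultimately show "adjacent G x y"
    using down_arc adjacent_sym[of G y x] unfolding adjacent_def by blast
qed

lemma connected_G: "connected_network G"
proof -
  obtain x0 where x0: "x0 \<in> I" using I_cases by auto
  have "(adjacent G)\<^sup>*\<^sup>* x0 v" if "v \<in> D" for v
    using that
  proof (induction v rule: D.induct)
    case (init x)
    have "x = x0 \<or> adjacent G x0 x"
      using I_cases x0 init unfolding adjacent_G_iff by (auto simp: insert_commute)
    then show ?case by auto
  next
    case (step n b j)
    then have "adjacent G (n, tail T2 b, j) (head T1 (c n b), head T2 b, j)"
      by (auto simp: adjacent_G_iff down_def)
    then show ?case using step.IH by simp
  qed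
  then show ?thesis
    using subnetwork_G by (intro connected_networkI[of G x0]) (auto simp: subnetwork_def G_def)
qed

text \<open>Arrows leaving \<open>m\<close> are served by \<open>c\<close>. Upwards, a vertex of
  \<open>I\<close> has a first coordinate without incoming arrow or a partner along the edge; any
  other vertex was entered by an arrow of \<open>G\<close>, whose first component is the only arrow
  of \<open>T1\<close> ending there.\<close>

lemma complete_G: "complete_network T1 F1 T2 G"
  unfolding complete_network_def
proof (intro ballI, clarsimp, intro conjI ballI impI)
  fix n m j b assume "(n, m, j) \<in> verts (quiver G)" "b \<in> arcs T2" "tail T2 b = m"
  then show "\<exists>a\<in>arcs T1. tail T1 a = n \<and> (a, b, j) \<in> arcs (quiver G)"
    using choice_D[of n b j] by (auto simp: G_def intro!: bexI[of _ "c n b"])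
next
  fix n m j a assume nm: "(n, m, j) \<in> verts (quiver G)" and a: "a \<in> arcs T1" "head T1 a = n"
  from nm have "(n, m, j) \<in> D" by (simp add: G_def)
  then show "(\<exists>b\<in>arcs T2. head T2 b = m \<and> (a, b, j) \<in> arcs (quiver G)) \<or>
    (\<exists>a'\<in>arcs T1. tail T1 a' = tail T1 a \<and> on_arr F1 a = on_arr F1 a' \<and>
       (head T1 a', m, - j) \<in> verts (quiver G) \<and> {(n, m, j), (head T1 a', m, - j)} \<in> edges G)"
  proof (cases rule: D.cases)
    case init
    from I_cases show ?thesis
    proof (elim disjE exE bexE conjE)
      fix r assume "I = {(r, m0, 1)}" "in_arcs T1 r = {}"
      then show ?thesis using init a by (auto simp: in_arcs_def)
    next
      fix a1 a2 assume I: "I = {(head T1 a1, m0, 1), (head T1 a2, m0, -1)}" "tail T1 a1 = tail T1 a2"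
        "on_arr F1 a1 = on_arr F1 a2" "head T1 a1 \<noteq> head T1 a2" "a1 \<in> arcs T1" "a2 \<in> arcs T1"
      then have card: "card I = 2" by simp
      have "I \<in> edges G" using card by (simp add: G_def)
      then have edge: "{(head T1 a1, m0, 1), (head T1 a2, m0, -1)} \<in> edges G"
        by (simp only: I(1)[symmetric])
      have "(head T1 a1, m0, 1) \<in> I" "(head T1 a2, m0, -1) \<in> I" unfolding I(1) by simp_all
      then have verts: "(head T1 a1, m0, 1) \<in> verts (quiver G)" "(head T1 a2, m0, -1) \<in> verts (quiver G)"
        by (simp_all add: G_def D.init)
      from init I(1) consider "n = head T1 a1" "m = m0" "j = 1" | "n = head T1 a2" "m = m0" "j = -1"
        by auto
      then show ?thesis
      proof cases
        case 1
        then have "a = a1" using a I A.in_arc_unique by auto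
        then show ?thesis
          using 1 I(2-) edge verts by (intro disjI2 bexI[of _ a2]) simp_all
      next
        case 2
        then have "a = a2" using a I A.in_arc_unique by auto
        then show ?thesis
          using 2 I(2-) edge verts by (intro disjI2 bexI[of _ a1]) (simp_all add: insert_commute)
      qed
    qed
  next
    case (step n1 b)
    then have "a = c n1 b" using choice_D a A.in_arc_unique by auto
    then show ?thesis using step by (auto simp: G_def)
  qed
qed

section \<open>Absence of triangles in the descending network\<close>

lemma adjacent_N1_cases:
  assumes "adjacent N1 (n, m) (n', m')"
  obtains (down) a b where "a \<in> arcs T1" "b \<in> arcs T2" "n = tail T1 a" "m = tail T2 b" "n' = head T1 a" "m' = head T2 b"
    | (up) a b where "a \<in> arcs T1" "b \<in> arcs T2" "n' = tail T1 a" "m' = tail T2 b" "n = head T1 a" "m = head T2 b"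
    | (edge) "m = m'"
proof -
  obtain l where l: "joins N1 l (n, m) (n', m')" using assms by (auto simp: adjacent_def)
  show ?thesis
  proof (cases l)
    case (Arrow t)
    then show ?thesis using l down unfolding joins_N1_Arrow by (cases t) (metis joins_N1_Arrow prod.inject)
  next
    case (Inverse t)
    then show ?thesis using l up by (cases t) (metis joins_N1_Inverse prod.inject)
  next
    case (Edge e)
    then have "{(n, m), (n', m')} \<in> edges N1" using l by auto
    then show ?thesis using edge edge_N1_iff by blast
  qed
qed

text \<open>Vertices adjacent in \<open>N1\<close> have second coordinates that are equal or joined
  by an arrow of \<open>T2\<close>; those of \<open>u\<close> and \<open>w\<close> are a vertex and
  its grandchild.\<close>

lemma no_triangle_down_down:
  assumes "down u v" "down v w"
  shows "\<not> adjacent N1 (proj u) (proj w)"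
proof
  assume adj: "adjacent N1 (proj u) (proj w)"
  obtain n b j where b: "b \<in> arcs T2" "u = (n, tail T2 b, j)" "v = (head T1 (c n b), head T2 b, j)"
    using assms by (auto simp: down_def)
  obtain n' b' where b': "b' \<in> arcs T2" "tail T2 b' = head T2 b" "w = (head T1 (c n' b'), head T2 b', j)"
    using assms b by (auto simp: down_def)
  have "adjacent N1 (n, tail T2 b) (head T1 (c n' b'), head T2 b')"
    using adj b b' by (simp add: proj_def)
  then show False
  proof (cases rule: adjacent_N1_cases)
    case (down a'' b'')
    then show ?thesis using B.in_arc_unique[of b'' b'] b b' no_loop_T2 by metis
  next
    case (up a'' b'')
    then show ?thesis using no_three_cycle_T2[of b b' b''] b b' by simp
  next
    case edge
    then show ?thesis using no_two_cycle_T2[of b b'] b b' by simp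
  qed
qed

text \<open>Two children of one vertex of \<open>T2\<close> are not joined by an arrow, and if they
  coincide, so do \<open>b\<close> and \<open>b'\<close> and hence \<open>u\<close> and
  \<open>w\<close>.\<close>

lemma no_triangle_fork:
  assumes "down v u" "down v w" "u \<noteq> w"
  shows "\<not> adjacent N1 (proj u) (proj w)"
proof
  assume adj: "adjacent N1 (proj u) (proj w)"
  obtain n b j where b: "b \<in> arcs T2" "v = (n, tail T2 b, j)" "u = (head T1 (c n b), head T2 b, j)"
    using assms(1) unfolding down_def by blast
  obtain b' where b': "b' \<in> arcs T2" "tail T2 b' = tail T2 b" "w = (head T1 (c n b'), head T2 b', j)"
    using assms(2) unfolding down_def b(2) by auto
  have "adjacent N1 (head T1 (c n b), head T2 b) (head T1 (c n b'), head T2 b')"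
    using adj b b' by (simp add: proj_def)
  then show False
  proof (cases rule: adjacent_N1_cases)
    case (down a'' b'')
    then show ?thesis using B.in_arc_unique[of b'' b'] b b' no_loop_T2 by metis
  next
    case (up a'' b'')
    then show ?thesis using B.in_arc_unique[of b'' b] b b' no_loop_T2 by metis
  next
    case edge
    then have "b = b'" by (rule B.in_arc_unique[OF b(1) b'(1)])
    then show ?thesis using b(3) b'(3) assms(3) by blast
  qed
qed

text \<open>Here \<open>T2\<close> would allow an arrow from \<open>u\<close> to \<open>w\<close>.
  It is excluded in \<open>T1\<close>: the only parent of the first coordinate of \<open>w\<close>
  is the first coordinate of \<open>v\<close>, not that of \<open>u\<close>.\<close>

lemma no_triangle_edge_down:
  assumes "I = {u, v}" "card I = 2" "down v w"
  shows "\<not> adjacent N1 (proj u) (proj w)"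
proof
  assume adj: "adjacent N1 (proj u) (proj w)"
  obtain n b j where b: "b \<in> arcs T2" "(n, tail T2 b, j) \<in> D" "v = (n, tail T2 b, j)"
    "w = (head T1 (c n b), head T2 b, j)"
    using assms(3) unfolding down_def by blast
  obtain n' j' where u: "u = (n', m0, j')"
    using assms(1) I_sign[of "fst u" "fst (snd u)" "snd (snd u)"] by (metis insertI1 prod.collapse)
  have v: "tail T2 b = m0"
    using assms(1) b I_sign[of n "tail T2 b" j] by simp
  have "n \<noteq> n'"
    using I_inj[of n "tail T2 b" j n' m0 j'] assms u v b by auto
  have "adjacent N1 (n', tail T2 b) (head T1 (c n b), head T2 b)"
    using adj u v b by (simp add: proj_def)
  then show False
  proof (cases rule: adjacent_N1_cases)
    case (down a'' b'')
    then show ?thesis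
      using A.in_arc_unique[of a'' "c n b"] choice_D[OF b(2,1)] \<open>n \<noteq> n'\<close> by simp
  next
    case (up a'' b'')
    then show ?thesis using no_two_cycle_T2[of b b''] b by simp
  next
    case edge
    then show ?thesis using no_loop_T2[OF b(1)] by simp
  qed
qed

lemma down_backward_unique: "down u v \<Longrightarrow> down w v \<Longrightarrow> u = w"
proof -
  assume "down u v" "down w v"
  then obtain n b j n' b' where b: "b \<in> arcs T2" "(n, tail T2 b, j) \<in> D" "u = (n, tail T2 b, j)"
    "v = (head T1 (c n b), head T2 b, j)" "b' \<in> arcs T2" "(n', tail T2 b', j) \<in> D" "w = (n', tail T2 b', j)"
    "head T2 b' = head T2 b"
    unfolding down_def by auto
  then have "b' = b" using B.in_arc_unique by simp
  then show ?thesis using b D_inj by blast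
qed

lemma down_not_I: "down u v \<Longrightarrow> v \<notin> I"
  using head_not_m0 I_sign unfolding down_def by blast

text \<open>Each link at the middle vertex goes down, up or along the edge. Going up twice, or along
  the edge twice, leads to the same vertex, and no vertex of \<open>I\<close> has a link upwards;
  the other combinations are the preceding lemmas.\<close>

lemma triangle_free_G: "traversals G \<inter> triangle_traversals2 T1 F1 T2 F2 = {}"
  unfolding triangle_free_iff[OF subnetwork_G]
proof (intro allI impI, elim conjE)
  fix u v w assume uv: "adjacent G u v" and vw: "adjacent G v w" and ne: "u \<noteq> w"
  have sym: "\<not> adjacent N1 (proj u) (proj w)" if "\<not> adjacent N1 (proj w) (proj u)"
    using that adjacent_sym[of N1] by blast
  define edge where "edge x y \<longleftrightarrow> card I = 2 \<and> I = {x, y}" for x y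
  have "down u v \<or> down v u \<or> edge u v" "down v w \<or> down w v \<or> edge v w"
    using uv vw by (simp_all only: adjacent_G_iff edge_def)
  then consider "down u v" "down v w" | "down v u" "down w v" | "down v u" "down v w"
    | "down u v" "down w v" | "edge u v" "edge v w" | "edge u v" "down v w" | "edge v w" "down v u"
    | "edge u v" "down w v" | "edge v w" "down u v"
    by blast
  then show "\<not> adjacent N1 (proj u) (proj w)"
  proof cases
    case 1 then show ?thesis by (rule no_triangle_down_down)
  next
    case 2 then show ?thesis by (intro sym no_triangle_down_down)
  next
    case 3 then show ?thesis using ne by (rule no_triangle_fork)
  next
    case 4 then show ?thesis using down_backward_unique ne by metis
  next
    case 5 then show ?thesis using ne unfolding edge_def by (metis doubleton_eq_iff)
  next
    case 6 then show ?thesis using no_triangle_edge_down unfolding edge_def by metis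
  next
    case 7
    then have "I = {w, v}" "card I = 2" unfolding edge_def by blast+
    then show ?thesis using 7(2) by (intro sym no_triangle_edge_down)
  next
    case 8 then show ?thesis using down_not_I[of w v] unfolding edge_def by blast
  next
    case 9 then show ?thesis using down_not_I[of u v] unfolding edge_def by blast
  qed
qed

lemma generalized_graph_map_G: "generalized_graph_map T1 F1 T2 F2 G"
proof -
  have "D \<noteq> {}" using I_cases D.init by blast
  moreover have "involution_free G"
    unfolding involution_free_def
  proof (intro allI impI notI)
    fix n m j assume "(n, m, j) \<in> verts (quiver G)" "(n, m, -j) \<in> verts (quiver G)"
    then have "(n, m, j) \<in> D" "(n, m, -j) \<in> D" by (simp_all add: G_def)
    then have "j = -j" "j \<in> {-1, 1}" using D_inj D_facts by blast+
    then show False by auto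
  qed
  ultimately show ?thesis
    unfolding generalized_graph_map_def complete_connected_free_def
    using subnetwork_G complete_G connected_G triangle_free_G by (simp add: G_def)
qed

lemma signed_count_G_supp: "signed_count G n m \<noteq> 0 \<Longrightarrow> P n m"
  using D_facts[of n m 1] D_facts[of n m "-1"] by (auto simp: signed_count_eq G_def split: if_splits)

lemma signed_count_G_init:
  assumes "(n, m0, 1) \<in> I"
  shows "signed_count G n m0 = 1"
proof -
  have "(n, m0, 1) \<in> D" using assms by (rule D.init)
  moreover have "(n, m0, -1) \<notin> D" using D_inj[OF calculation] by force
  ultimately show ?thesis by (simp add: signed_count_eq G_def)
qed

end

section \<open>Graph maps inside a support and the spanning property\<close>

context tree_pair begin

lemma exists_minimal_support:
  fixes h :: "'n \<Rightarrow> 'm \<Rightarrow> 'k::field"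
  assumes "h x y \<noteq> 0"
  shows "\<exists>n m. h n m \<noteq> 0 \<and> (\<forall>n'. \<forall>b\<in>arcs T2. head T2 b = m \<longrightarrow> h n' (tail T2 b) = 0)"
proof -
  obtain m0 where m0: "m0 \<in> {m. \<exists>n. h n m \<noteq> 0}"
    "\<And>m. (m, m0) \<in> arcs_ends T2 \<Longrightarrow> m \<notin> {m. \<exists>n. h n m \<noteq> 0}"
    using wfE_min[OF B.wf_arcs_ends, of y "{m. \<exists>n. h n m \<noteq> 0}"] assms by blast
  then obtain n0 where "h n0 m0 \<noteq> 0" by blast
  moreover have "h n' (tail T2 b) = 0" if "b \<in> arcs T2" "head T2 b = m0" for n' b
    using m0(2) arc_T2[OF that(1)] that(2) by blast
  ultimately show ?thesis by blast
qed

lemma exists_graph_map_in_support: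
  assumes h: "hom_matrix T1 F1 T2 F2 h" and nz: "h n0 m0 \<noteq> (0::'k::field)"
    and minimal: "\<And>n' b. b \<in> arcs T2 \<Longrightarrow> head T2 b = m0 \<Longrightarrow> h n' (tail T2 b) = 0"
  shows "\<exists>G. generalized_graph_map T1 F1 T2 F2 G \<and> signed_count G n0 m0 = 1 \<and>
    (\<forall>n m. signed_count G n m \<noteq> 0 \<longrightarrow> h n m \<noteq> 0)"
proof -
  have supp: "n \<in> verts T1 \<and> m \<in> verts T2 \<and> on_vert F1 n = on_vert F2 m" if "h n m \<noteq> 0" for n m
    using h that by (auto simp: hom_matrix_def)
  have eq: "(\<Sum>a | a \<in> arcs T1 \<and> tail T1 a = n \<and> on_arr F1 a = \<gamma>. h (head T1 a) m) =
      (\<Sum>b | b \<in> arcs T2 \<and> head T2 b = m \<and> on_arr F2 b = \<gamma>. h n (tail T2 b))" for n \<gamma> m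
    using h by (simp add: hom_matrix_def)
  define c where "c n b = (SOME a. a \<in> arcs T1 \<and> tail T1 a = n \<and> on_arr F1 a = on_arr F2 b \<and>
    h (head T1 a) (head T2 b) \<noteq> 0)" for n b
  have c: "c n b \<in> arcs T1 \<and> tail T1 (c n b) = n \<and> on_arr F1 (c n b) = on_arr F2 b \<and>
      h (head T1 (c n b)) (head T2 b) \<noteq> 0" if "h n (tail T2 b) \<noteq> 0" "b \<in> arcs T2" for n b
  proof -
    \<comment> \<open>The right-hand sum is the single term \<open>h n (tail T2 b)\<close>, which is
      nonzero, so some child of \<open>n\<close> along the colour of \<open>b\<close> stays in the
      support.\<close>
    have "{b'. b' \<in> arcs T2 \<and> head T2 b' = head T2 b \<and> on_arr F2 b' = on_arr F2 b} = {b}"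
      using that B.in_arc_unique by auto
    then have "(\<Sum>a | a \<in> arcs T1 \<and> tail T1 a = n \<and> on_arr F1 a = on_arr F2 b. h (head T1 a) (head T2 b)) \<noteq> 0"
      using eq[where n = n and \<gamma> = "on_arr F2 b" and m = "head T2 b"] that by simp
    then obtain a where "a \<in> {a. a \<in> arcs T1 \<and> tail T1 a = n \<and> on_arr F1 a = on_arr F2 b}"
      "h (head T1 a) (head T2 b) \<noteq> 0"
      by (rule sum.not_neutral_contains_not_neutral)
    then show ?thesis
      unfolding c_def by (intro someI_ex[of "\<lambda>a. a \<in> arcs T1 \<and> tail T1 a = n \<and>
        on_arr F1 a = on_arr F2 b \<and> h (head T1 a) (head T2 b) \<noteq> 0"]) blast
  qed
  have "\<exists>I. (n0, m0, 1) \<in> I \<and> descent T1 T2 Q F1 F2 (\<lambda>n m. h n m \<noteq> 0) c I m0"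
  proof (cases "in_arcs T1 n0 = {}")
    case True
    then have "descent T1 T2 Q F1 F2 (\<lambda>n m. h n m \<noteq> 0) c {(n0, m0, 1)} m0"
      using supp c nz by unfold_locales auto
    then show ?thesis by blast
  next
    case False
    then obtain a where a: "a \<in> arcs T1" "head T1 a = n0" by (auto simp: in_arcs_def)
    \<comment> \<open>Minimality of \<open>m0\<close> makes the right-hand side vanish, so
      \<open>h n0 m0\<close> has to be cancelled by a sibling \<open>a'\<close>. This is the origin
      of the edge in the graph map.\<close>
    let ?C = "{a'. a' \<in> arcs T1 \<and> tail T1 a' = tail T1 a \<and> on_arr F1 a' = on_arr F1 a}"
    have "(\<Sum>a'\<in>?C. h (head T1 a') m0) = 0"
      unfolding eq using minimal by (intro sum.neutral) auto
    then have "(\<Sum>a'\<in>?C - {a}. h (head T1 a') m0) = - h n0 m0"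
      using a sum.remove[of ?C a "\<lambda>a'. h (head T1 a') m0"] by (simp add: eq_neg_iff_add_eq_0 add.commute)
    then have "(\<Sum>a'\<in>?C - {a}. h (head T1 a') m0) \<noteq> 0" using nz by simp
    then obtain a' where a': "a' \<in> ?C - {a}" "h (head T1 a') m0 \<noteq> 0"
      by (rule sum.not_neutral_contains_not_neutral)
    then have "head T1 a \<noteq> head T1 a'" using a A.in_arc_unique by auto
    then have "descent T1 T2 Q F1 F2 (\<lambda>n m. h n m \<noteq> 0) c {(head T1 a, m0, 1), (head T1 a', m0, -1)} m0"
      using supp c nz a a' by unfold_locales (auto, (intro bexI[of _ a] bexI[of _ a'] conjI; simp))
    then show ?thesis using a by blast
  qed
  then obtain I where I: "(n0, m0, 1) \<in> I" "descent T1 T2 Q F1 F2 (\<lambda>n m. h n m \<noteq> 0) c I m0" by blast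
  interpret descent T1 T2 Q F1 F2 "\<lambda>n m. h n m \<noteq> 0" c I m0 by (rule I(2))
  show ?thesis
    using generalized_graph_map_G signed_count_G_init[OF I(1)] signed_count_G_supp by blast
qed

lemma matrix_map_in_span:
  assumes "hom_matrix T1 F1 T2 F2 (h :: 'n \<Rightarrow> 'm \<Rightarrow> 'k::field)"
  shows "matrix_map T1 h \<in>
    module.span map_scale {associated_map T1 G | G. generalized_graph_map T1 F1 T2 F2 G}"
  using assms
proof (induction "card {(n, m). h n m \<noteq> 0}" arbitrary: h rule: less_induct)
  case less
  interpret V: vector_space "map_scale :: 'k \<Rightarrow> (('n \<Rightarrow> 'k) \<Rightarrow> 'm \<Rightarrow> 'k) \<Rightarrow> _"
    by (rule vector_space_map_scale)
  show ?case
  proof (cases "\<forall>n m. h n m = 0")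
    case True
    then have "matrix_map T1 h = 0" by (auto simp: matrix_map_def fun_eq_iff)
    then show ?thesis by (simp only: V.span_zero)
  next
    case False
    then obtain x y where "h x y \<noteq> 0" by blast
    from exists_minimal_support[of h, OF this] obtain n m
      where nm: "h n m \<noteq> 0" "\<And>n' b. b \<in> arcs T2 \<Longrightarrow> head T2 b = m \<Longrightarrow> h n' (tail T2 b) = 0"
      by blast
    obtain G where G: "generalized_graph_map T1 F1 T2 F2 G" "signed_count G n m = 1"
      "\<And>n m. signed_count G n m \<noteq> 0 \<Longrightarrow> h n m \<noteq> 0"
      using exists_graph_map_in_support[of h n m, OF less.prems nm] by blast
    interpret G: complete_free_network T1 T2 Q F1 F2 G
      using G(1) by unfold_locales (auto simp: generalized_graph_map_def complete_connected_free_def)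
    define g :: "'n \<Rightarrow> 'm \<Rightarrow> 'k" where "g = (\<lambda>n m. of_int (signed_count G n m))"
    \<comment> \<open>The entry of \<open>G\<close> at \<open>(n, m)\<close> is 1, so
      \<open>h n m\<close> is the coefficient that clears this position; \<open>g\<close> vanishes
      wherever \<open>h\<close> does, so no new position appears.\<close>
    define h' where "h' = (\<lambda>x y. h x y - h n m * g x y)"
    have "hom_matrix T1 F1 T2 F2 h'"
      unfolding h'_def g_def using less.prems G.hom_matrix_signed_count by (rule hom_matrix_diff_scale)
    moreover have "{(n, m). h' n m \<noteq> 0} \<subset> {(n, m). h n m \<noteq> 0}"
    proof (rule psubsetI)
      show "{(n, m). h' n m \<noteq> 0} \<subseteq> {(n, m). h n m \<noteq> 0}"
        using G(3) by (auto simp: h'_def g_def) (metis of_int_0)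
      show "{(n, m). h' n m \<noteq> 0} \<noteq> {(n, m). h n m \<noteq> 0}"
        using nm(1) G(2) by (auto simp: h'_def g_def set_eq_iff intro!: exI[of _ n] exI[of _ m])
    qed
    moreover have "n \<in> verts T1 \<and> m \<in> verts T2" if "h n m \<noteq> 0" for n m
      using less.prems that unfolding hom_matrix_def by blast
    then have "finite {(n, m). h n m \<noteq> 0}"
      by (auto intro!: finite_subset[of "{(n, m). h n m \<noteq> 0}" "verts T1 \<times> verts T2"])
    ultimately have "matrix_map T1 h' \<in>
        V.span {associated_map T1 G | G. generalized_graph_map T1 F1 T2 F2 G}"
      using less.hyps psubset_card_mono by blast
    moreover have "associated_map T1 G = matrix_map T1 g"
      unfolding g_def by (rule associated_map_eq_matrix_map[OF G.sub])
    then have "map_scale (h n m) (matrix_map T1 g) \<in>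
        V.span {associated_map T1 G | G. generalized_graph_map T1 F1 T2 F2 G}"
      using G(1) by (intro V.span_scale V.span_base) (auto intro: exI[of _ G])
    moreover have "matrix_map T1 h = matrix_map T1 h' + map_scale (h n m) (matrix_map T1 g)"
      unfolding matrix_map_scale[symmetric] matrix_map_add[symmetric]
      by (rule arg_cong[where f = "matrix_map T1"]) (auto simp: h'_def fun_eq_iff)
    ultimately show ?thesis by (simp only: V.span_add)
  qed
qed

text \<open>Beyond \<open>matrix_map_in_span\<close>, this rests on
  \<open>hom_matrix_signed_count\<close>, which places every associated map in the space of
  homomorphisms, and on that space being closed under linear combinations.\<close>

lemma span_associated_maps:
  "rep_hom Q (tree_module T1 F1 :: ('q, 'a, 'n \<Rightarrow> 'k::field) rep) (tree_module T2 F2) =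
    module.span map_scale {associated_map T1 G | G. generalized_graph_map T1 F1 T2 F2 G}"
proof -
  interpret V: vector_space "map_scale :: 'k \<Rightarrow> (('n \<Rightarrow> 'k) \<Rightarrow> 'm \<Rightarrow> 'k) \<Rightarrow> _"
    by (rule vector_space_map_scale)
  let ?H = "rep_hom Q (tree_module T1 F1 :: ('q, 'a, 'n \<Rightarrow> 'k) rep) (tree_module T2 F2)"
  let ?S = "{associated_map T1 G | G. generalized_graph_map T1 F1 T2 F2 G} :: (('n \<Rightarrow> 'k) \<Rightarrow> 'm \<Rightarrow> 'k) set"
  have H: "?H = matrix_map T1 ` {h. hom_matrix T1 F1 T2 F2 h}"
    using A.fin_digraph_axioms B.fin_digraph_axioms mor1 mor2 by (rule rep_hom_tree_modules)
  have "?H \<subseteq> V.span ?S"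
    unfolding H using matrix_map_in_span by blast
  moreover have "V.span ?S \<subseteq> ?H"
  proof (rule V.span_minimal)
    show "?S \<subseteq> ?H"
    proof
      fix f :: "('n \<Rightarrow> 'k) \<Rightarrow> 'm \<Rightarrow> 'k" assume "f \<in> ?S"
      then obtain G where G: "generalized_graph_map T1 F1 T2 F2 G" "f = associated_map T1 G" by blast
      interpret G: complete_free_network T1 T2 Q F1 F2 G
        using G(1) by unfold_locales (auto simp: generalized_graph_map_def complete_connected_free_def)
      show "f \<in> ?H"
        unfolding H G(2) associated_map_eq_matrix_map[OF G.sub]
        using G.hom_matrix_signed_count by blast
    qed
    have add: "matrix_map T1 (h + h') \<in> ?H" if "hom_matrix T1 F1 T2 F2 h" "hom_matrix T1 F1 T2 F2 h'"
      for h h' :: "'n \<Rightarrow> 'm \<Rightarrow> 'k"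
      using hom_matrix_diff_scale[OF that, of "-1"] unfolding H
      by (intro image_eqI[of _ _ "h + h'"]) (simp_all add: plus_fun_def)
    have scale: "matrix_map T1 (\<lambda>n m. k * h n m) \<in> ?H" if "hom_matrix T1 F1 T2 F2 h"
      for h :: "'n \<Rightarrow> 'm \<Rightarrow> 'k" and k
    proof -
      have "hom_matrix T1 F1 T2 F2 (\<lambda>n m. h n m - (1 - k) * h n m)"
        using that that by (rule hom_matrix_diff_scale)
      then have "hom_matrix T1 F1 T2 F2 (\<lambda>n m. k * h n m)" by (simp add: algebra_simps)
      then show ?thesis unfolding H by blast
    qed
    have "hom_matrix T1 F1 T2 F2 (\<lambda>n m. 0 :: 'k)" by (simp add: hom_matrix_def)
    then have "matrix_map T1 (\<lambda>n m. 0 :: 'k) \<in> ?H" unfolding H by blast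
    moreover have zero: "matrix_map T1 (\<lambda>n m. 0 :: 'k) = (0 :: ('n \<Rightarrow> 'k) \<Rightarrow> 'm \<Rightarrow> 'k)"
      by (auto simp: matrix_map_def fun_eq_iff)
    ultimately have "0 \<in> ?H" by (simp only: zero)
    moreover have "f + g \<in> ?H" if "f \<in> ?H" "g \<in> ?H" for f g
      using that add unfolding H by (auto simp only: image_iff mem_Collect_eq matrix_map_add[symmetric])
    moreover have "map_scale k f \<in> ?H" if "f \<in> ?H" for k f
      using that scale unfolding H by (auto simp only: image_iff mem_Collect_eq matrix_map_scale[symmetric])
    ultimately show "V.subspace ?H"
      unfolding V.subspace_def by blast
  qed
  ultimately show ?thesis by blast
qed

end

theorem proposition4p2:
  fixes Q :: "('q, 'a) pre_digraph" and \<rho> :: "('q, 'a) path set"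
    and T1 :: "('n, 'e) pre_digraph" and F1 :: "('n, 'e, 'q, 'a) quiver_map"
    and T2 :: "('m, 'f) pre_digraph" and F2 :: "('m, 'f, 'q, 'a) quiver_map"
  assumes "CHAR('k::field) \<noteq> 2"
    and "bound_quiver TYPE('k) Q \<rho>"
    and "rooted_tree_over TYPE('k) Q \<rho> T1 F1"
    and "rooted_tree_over TYPE('k) Q \<rho> T2 F2"
  shows "ghost_free TYPE('k) T1 F1 T2 F2 \<and>
    rep_hom Q (tree_module T1 F1 :: ('q, 'a, 'n \<Rightarrow> 'k) rep) (tree_module T2 F2) =
      module.span map_scale {associated_map T1 G | G. generalized_graph_map T1 F1 T2 F2 G}"
proof -
  have "rooted_tree T1" "rooted_tree T2" and mor: "quiver_morphism T1 Q F1" "quiver_morphism T2 Q F2"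
    using assms by (auto simp: rooted_tree_over_def bound_morphism_def)
  then interpret A: arborescence T1 + B: arborescence T2
    by (simp_all add: rooted_tree_imp_arborescence)
  interpret tree_pair T1 T2 Q F1 F2
    using mor by unfold_locales
  show ?thesis
    using ghost_free span_associated_maps by blast
qed

end
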